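(* Let $m:\mathbb{R}\times\mathbb{R}\to\mathbb{S}^2$ be a solution of the half-wave maps equation of the rational form described in the context, with spins $s_1,\dots,s_N$ and poles $x_1,\dots,x_N$. (i) Assume that the asymptotic speeds satisfy $v_i\neq v_j$ for all $i\neq j$. Then for $t>T$ with $T$ large enough, including $t=+\infty$, the spins are globally bounded and the poles stay away from the real axis; that is, there exist $T>0$, $B_1<\infty$ and $B_2>0$ such that $|s_j(t)|\le B_1$ and $\mathrm{Im}(x_j(t))\ge B_2$ for all $t>T$ and all $j\in\{1,\dots,N\}$ (so that the bounds persist as $t\to+\infty$). (ii) Assume that the poles stay away from each other, that is, there is $\eta>0$ such that $|x_j(t)-x_k(t)|\ge\eta$ for all $j\neq k$ and all times $t$. Then the spins are globally bounded and the poles stay away from the real axis; that is, there exist $B_1<\infty$ and $B_2>0$ such that $|s_j(t)|\le B_1$ and $\mathrm{Im}(x_j(t))\ge B_2$ for all times $t$ and all $j\in\{1,\dots,N\}$.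
   Context: Notation: for $u,v\in\mathbb{C}^3$, $u\cdot v=u_1v_1+u_2v_2+u_3v_3$ and $u\times v$ are the complex-bilinear dot and cross products, $\bar u$ is the complex conjugate, $|u|=\sqrt{u\cdot\bar u}$. $\mathbb{C}^+$ is the open upper half plane. $\mathbb{S}^2\subset\mathbb{R}^3$ is the unit sphere. Half-wave maps equation: $m_t=m\times|\nabla|m$ for $m=m(x,t)\in\mathbb{S}^2$, $x\in\mathbb{R}$, $t\in\mathbb{R}$, where $\widehat{|\nabla|u}(\xi)=|\xi|\hat u(\xi)$. Rational form: $$m(x,t)=m_0+i\sum_{j=1}^N\frac{s_j(t)}{x-x_j(t)}-i\sum_{j=1}^N\frac{\bar s_j(t)}{x-\bar x_j(t)},$$ with $m_0$ a constant vector, nonzero spins $s_j(t)\in\mathbb{C}^3$ and pairwise distinct poles $x_j(t)\in\mathbb{C}^+$, evolving according to $$\dot s_j=-2\sum_{k\neq j}\frac{s_j\times s_k}{(x_j-x_k)^2},\qquad \ddot x_j=4\sum_{k\ne j}\frac{s_j\cdot s_k}{(x_j-x_k)^3},$$ with, at $t=0$, $$\dot x_j=\frac{s_j\times\bar s_j}{s_j\cdot\bar s_j}\cdot\Big(i m_0-\sum_{k\ne j}\frac{s_k}{x_j-x_k}+\sum_{k=1}^N\frac{\bar s_k}{x_j-\bar x_k}\Big).$$ Since $m$ takes values in $\mathbb{S}^2$, the constraints $s_j\cdot s_j=0$ and $s_j\cdot\big(i m_0-\sum_{k\ne j}\frac{s_k}{x_j-x_k}+\sum_{k}\frac{\bar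 s_k}{x_j-\bar x_k}\big)=0$ are imposed. Asymptotic speeds: let $L=(l_{jk})$ and $B=(b_{jk})$ be the $N\times N$ matrices $l_{jk}=\delta_{jk}\dot x_j+(1-\delta_{jk})\frac{\epsilon_{jk}\sqrt{2s_j\cdot s_k}}{x_j-x_k}$ and $b_{jk}=(1-\delta_{jk})\frac{\epsilon_{jk}\sqrt{2s_j\cdot s_k}}{(x_j-x_k)^2}$, where $\epsilon_{jk}=-\epsilon_{kj}$ and $\epsilon_{jk}^2=1-\delta_{jk}$. They form a Lax pair, $\dot L=BL-LB$, so the spectrum of $L$ is constant in time, and the poles at time $t$ are the eigenvalues of $L(0)t+\mathrm{diag}(x_1(0),\dots,x_N(0))$. The speeds $v_1,\dots,v_N$ are the eigenvalues of $L$; they are real with $|v_i|\le1$, and $x_i(t)$ is equivalent to $v_it$ for large times. *)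

theory Defs
  imports "HOL-Analysis.Analysis"
begin

section \<open>Complex-bilinear vector algebra\<close>

(* The library's inner product on complex^3 is the real one and cross3 is for real^3 only.
   The Hermitian length sqrt (u . conj u) is the library norm on complex^3. *)

definition cdot :: "complex^3 \<Rightarrow> complex^3 \<Rightarrow> complex" where
  "cdot u v = (\<Sum>i\<in>UNIV. u $ i * v $ i)"

definition ccross :: "complex^3 \<Rightarrow> complex^3 \<Rightarrow> complex^3" where
  "ccross u v = vector
     [u $ 2 * v $ 3 - u $ 3 * v $ 2,
      u $ 3 * v $ 1 - u $ 1 * v $ 3,
      u $ 1 * v $ 2 - u $ 2 * v $ 1]"

definition cconj :: "complex^3 \<Rightarrow> complex^3" where
  "cconj u = (\<chi> i. cnj (u $ i))"

definition cvec :: "real^3 \<Rightarrow> complex^3" where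
  "cvec u = (\<chi> i. complex_of_real (u $ i))"


section \<open>The half-wave maps equation\<close>

definition square_integrable :: "(real \<Rightarrow> complex) \<Rightarrow> bool" where
  "square_integrable f \<longleftrightarrow>
     f \<in> borel_measurable lborel \<and> integrable lborel (\<lambda>x. (cmod (f x))\<^sup>2)"

(* g is the Fourier transform of f in the L2 (Plancherel) sense: the L2-limit of the transforms
   of the truncations of f to [-R,R].  L1 would not do: m - m0 decays only like 1/x. *)
definition has_fourier_L2 :: "(real \<Rightarrow> complex) \<Rightarrow> (real \<Rightarrow> complex) \<Rightarrow> bool" where
  "has_fourier_L2 f g \<longleftrightarrow>
     square_integrable f \<and> square_integrable g \<and>
     ((\<lambda>R. \<integral>\<^sup>+\<xi>. ennreal ((cmod (g \<xi> - (LINT x:{-R..R}|lborel. exp (- \<i> * of_real (x * \<xi>)) * f x)))\<^sup>2)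
            \<partial>lborel) \<longlongrightarrow> 0) at_top"

(* w is |nabla| u, the Fourier multiplier with symbol |xi|, for u in "constant + L2": the transform
   of the constant c is supported at xi = 0, where the symbol vanishes.  Continuity selects the
   pointwise representative of w. *)
definition has_abs_nabla :: "(real \<Rightarrow> real) \<Rightarrow> (real \<Rightarrow> real) \<Rightarrow> bool" where
  "has_abs_nabla u w \<longleftrightarrow>
     continuous_on UNIV w \<and>
     (\<exists>c g. has_fourier_L2 (\<lambda>x. complex_of_real (u x - c)) g \<and>
            has_fourier_L2 (\<lambda>x. complex_of_real (w x)) (\<lambda>\<xi>. of_real \<bar>\<xi>\<bar> * g \<xi>))"

(* m x t, with space variable x and time variable t *)
definition half_wave_map :: "(real \<Rightarrow> real \<Rightarrow> real^3) \<Rightarrow> bool" where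
  "half_wave_map m \<longleftrightarrow>
     (\<forall>x t. m x t \<in> sphere 0 1) \<and>
     (\<forall>t. \<exists>w. (\<forall>i. has_abs_nabla (\<lambda>x. m x t $ i) (\<lambda>x. w x $ i)) \<and>
              (\<forall>x. ((\<lambda>\<tau>. m x \<tau>) has_vector_derivative cross3 (m x t) (w x)) (at t)))"


section \<open>Rational solutions: spins and poles\<close>

(* The number N of poles is CARD('n).  s t j and x t j are the j-th spin and pole at time t. *)

definition has_rational_form ::
  "(real \<Rightarrow> real \<Rightarrow> real^3) \<Rightarrow> real^3 \<Rightarrow> (real \<Rightarrow> 'n::finite \<Rightarrow> complex^3) \<Rightarrow> (real \<Rightarrow> 'n \<Rightarrow> complex) \<Rightarrow> bool"
where
  "has_rational_form m m0 s x \<longleftrightarrow>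
     (\<forall>t j. s t j \<noteq> 0 \<and> Im (x t j) > 0) \<and>
     (\<forall>t. inj (x t)) \<and>
     (\<forall>y t. cvec (m y t) = cvec m0
        + \<i> *s (\<Sum>j\<in>UNIV. (1 / (of_real y - x t j)) *s s t j)
        - \<i> *s (\<Sum>j\<in>UNIV. (1 / (of_real y - cnj (x t j))) *s cconj (s t j)))"

definition pole_field ::
  "real^3 \<Rightarrow> ('n::finite \<Rightarrow> complex^3) \<Rightarrow> ('n \<Rightarrow> complex) \<Rightarrow> 'n \<Rightarrow> complex^3" where
  "pole_field m0 s x j =
     \<i> *s cvec m0
     - (\<Sum>k\<in>UNIV - {j}. (1 / (x j - x k)) *s s k)
     + (\<Sum>k\<in>UNIV. (1 / (x j - cnj (x k))) *s cconj (s k))"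

definition spin_pole_constraints ::
  "real^3 \<Rightarrow> (real \<Rightarrow> 'n::finite \<Rightarrow> complex^3) \<Rightarrow> (real \<Rightarrow> 'n \<Rightarrow> complex) \<Rightarrow> bool" where
  "spin_pole_constraints m0 s x \<longleftrightarrow>
     (\<forall>t j. cdot (s t j) (s t j) = 0 \<and> cdot (s t j) (pole_field m0 (s t) (x t) j) = 0)"

(* x' is the velocity of the poles.  The sign \<sigma> is 1 or -1.  The dynamics is usually printed with
   \<sigma> = 1; for poles in the upper half plane that choice belongs to m_t = - m \<times> |nabla| m
   (that is, m_t = m \<times> H m_x with H the multiplier i sgn xi).  Inserting the rational form into
   m_t = m \<times> |nabla| m, with |nabla| having the symbol + |xi|, gives \<sigma> = -1.  The two cases
   are exchanged by (m, m0, s, x) \<mapsto> (-m, -m0, -s, x). *)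
definition spin_pole_dynamics ::
  "real \<Rightarrow> real^3 \<Rightarrow> (real \<Rightarrow> 'n::finite \<Rightarrow> complex^3) \<Rightarrow> (real \<Rightarrow> 'n \<Rightarrow> complex)
     \<Rightarrow> (real \<Rightarrow> 'n \<Rightarrow> complex) \<Rightarrow> bool" where
  "spin_pole_dynamics \<sigma> m0 s x x' \<longleftrightarrow>
     (\<forall>t j. ((\<lambda>\<tau>. s \<tau> j) has_vector_derivative
        of_real \<sigma> *s (- 2 *s (\<Sum>k\<in>UNIV - {j}. (1 / (x t j - x t k)\<^sup>2) *s ccross (s t j) (s t k)))) (at t)) \<and>
     (\<forall>t j. ((\<lambda>\<tau>. x \<tau> j) has_vector_derivative x' t j) (at t)) \<and>
     (\<forall>t j. ((\<lambda>\<tau>. x' \<tau> j) has_vector_derivative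
        4 * (\<Sum>k\<in>UNIV - {j}. cdot (s t j) (s t k) / (x t j - x t k) ^ 3)) (at t)) \<and>
     (\<forall>j. x' 0 j = of_real \<sigma> *
        cdot ((1 / cdot (s 0 j) (cconj (s 0 j))) *s ccross (s 0 j) (cconj (s 0 j)))
             (pole_field m0 (s 0) (x 0) j))"


section \<open>Lax pair and asymptotic speeds\<close>

definition lax_L ::
  "('n \<Rightarrow> 'n \<Rightarrow> complex) \<Rightarrow> ('n \<Rightarrow> complex^3) \<Rightarrow> ('n \<Rightarrow> complex) \<Rightarrow> ('n \<Rightarrow> complex) \<Rightarrow> complex^'n^'n::finite"
where
  "lax_L \<epsilon> s x x' = (\<chi> j k. if j = k then x' j
     else \<epsilon> j k * csqrt (2 * cdot (s j) (s k)) / (x j - x k))"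

definition lax_B ::
  "('n \<Rightarrow> 'n \<Rightarrow> complex) \<Rightarrow> ('n \<Rightarrow> complex^3) \<Rightarrow> ('n \<Rightarrow> complex) \<Rightarrow> complex^'n^'n::finite"
where
  "lax_B \<epsilon> s x = (\<chi> j k. if j = k then 0
     else \<epsilon> j k * csqrt (2 * cdot (s j) (s k)) / (x j - x k)\<^sup>2)"

(* The signs have to be those for which L and B form a Lax pair; other antisymmetric signs
   change the spectrum of L as soon as N >= 3.  They depend on time because csqrt is the principal
   root: when 2 s_j . s_k crosses the branch cut, \<epsilon> jumps so that \<epsilon> * csqrt stays smooth. *)
definition lax_signs ::
  "(real \<Rightarrow> 'n \<Rightarrow> 'n \<Rightarrow> complex) \<Rightarrow> (real \<Rightarrow> 'n::finite \<Rightarrow> complex^3) \<Rightarrow> (real \<Rightarrow> 'n \<Rightarrow> complex)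
     \<Rightarrow> (real \<Rightarrow> 'n \<Rightarrow> complex) \<Rightarrow> bool" where
  "lax_signs \<epsilon> s x x' \<longleftrightarrow>
     (\<forall>t j k. \<epsilon> t j k = - \<epsilon> t k j \<and> (\<epsilon> t j k)\<^sup>2 = (if j = k then 0 else 1)) \<and>
     (\<forall>t. ((\<lambda>\<tau>. lax_L (\<epsilon> \<tau>) (s \<tau>) (x \<tau>) (x' \<tau>)) has_vector_derivative
        lax_B (\<epsilon> t) (s t) (x t) ** lax_L (\<epsilon> t) (s t) (x t) (x' t)
        - lax_L (\<epsilon> t) (s t) (x t) (x' t) ** lax_B (\<epsilon> t) (s t) (x t)) (at t))"

(* v lists the eigenvalues of A with algebraic multiplicity *)
definition eigenvalue_list :: "complex^'n^'n::finite \<Rightarrow> ('n \<Rightarrow> complex) \<Rightarrow> bool" where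
  "eigenvalue_list A v \<longleftrightarrow> (\<forall>z. det (mat z - A) = (\<Prod>j\<in>UNIV. z - v j))"

(* The spectrum of L is constant in time, so it is read off at time 0. *)
definition asymptotic_speeds ::
  "(real \<Rightarrow> 'n::finite \<Rightarrow> complex^3) \<Rightarrow> (real \<Rightarrow> 'n \<Rightarrow> complex) \<Rightarrow> (real \<Rightarrow> 'n \<Rightarrow> complex)
     \<Rightarrow> ('n \<Rightarrow> complex) \<Rightarrow> bool" where
  "asymptotic_speeds s x x' v \<longleftrightarrow>
     (\<exists>\<epsilon>. lax_signs \<epsilon> s x x' \<and> eigenvalue_list (lax_L (\<epsilon> 0) (s 0) (x 0) (x' 0)) v)"

end

theory Submission
  imports Defs
begin

text \<open>
  The total spin and the sum of the heights \<open>Im x\<^sub>j\<close> are conserved, and summing the constraints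
  expresses the \<open>L\<^sup>2\<close> norm of the map minus its limit through the total spin. In the Hardy space
  the residue \<open>s\<^sub>j\<close> is bounded by this norm, up to Blaschke factors that are harmless
  as long as the poles are separated; distinct asymptotic speeds separate the poles for large times.

  The poles always stay away from the real axis. Writing the null vectors \<open>s\<^sub>j\<close> as products of spinors
  makes the Lax matrix \<open>L\<close> at time \<open>0\<close> self-adjoint for the Gram matrix of the functions
  \<open>\<psi>\<^sub>j / (y - x\<^sub>j)\<close>, while the diagonal matrix \<open>X\<close> of the initial poles is dissipative and commutes with
  \<open>L\<close> on vectors without dissipation. The poles at time \<open>t\<close> are the eigenvalues of \<open>t L + X\<close>. If their
  imaginary parts approached \<open>0\<close>, normalized eigenvectors would accumulate at an eigenvector of \<open>X\<close>
  with a real eigenvalue, but the eigenvalues of \<open>X\<close> lie in the upper half plane.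
\<close>

section \<open>Isospectral deformations of matrices\<close>

text \<open>The velocity formula is prescribed only at time 0, and \<open>lax_signs\<close> is at
  hand only in part (i). The bound on the heights therefore works with a Lax matrix built from
  spinors instead of square roots, uses its self-adjointness only at time 0, and reaches other times
  through the pencil \<open>t L + X\<close>. Spinors are chosen smoothly only near each time,
  because each of the two explicit formulas fails on some null vectors; the determinant of the
  pencil does not depend on the choice and so makes sense for all times.

  The obstacle for the heights is that the dissipation of \<open>X\<close> has rank at most two, so
  for N > 2 some vectors have none. On the function side, a vector u stands for f(y) = \<Sum> u_k
  \<psi>_k / (y - x_k), and \<open>X\<close> is multiplication by y followed by removal of the
  constant \<Sum> u_k \<psi>_k. This constant controls both the dissipation of u and the commutator
  of \<open>L\<close> and \<open>X\<close> on u, which is what makes the limit argument close.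

  Both sign conventions are covered at once: the matrix carries the factor i \<sigma>, whose square
  is -1 either way.\<close>

lemma has_vector_derivative_vec:
  fixes f :: "real \<Rightarrow> 'a::euclidean_space^'n::finite"
  assumes "\<And>i. ((\<lambda>u. f u $ i) has_vector_derivative f' $ i) (at t)"
  shows "(f has_vector_derivative f') (at t)"
  unfolding has_vector_derivative_def
proof (subst has_derivative_componentwise_within, intro ballI)
  fix b :: "'a^'n" assume "b \<in> Basis"
  then obtain i c where b: "b = axis i c" by (auto simp: Basis_vec_def)
  show "((\<lambda>u. f u \<bullet> b) has_derivative (\<lambda>h. (h *\<^sub>R f') \<bullet> b)) (at t)"
    using has_derivative_inner_left[OF assms[of i, unfolded has_vector_derivative_def], of c]
    by (simp add: b inner_axis)
qed

lemma has_vector_derivative_vec_nth: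
  "(f has_vector_derivative f') (at t) \<Longrightarrow> ((\<lambda>u. f u $ i) has_vector_derivative f' $ i) (at t)"
  by (rule bounded_linear.has_vector_derivative[OF bounded_linear_vec_nth])

text \<open>The value depends on the curve only through \<open>A t\<close> and \<open>A'\<close>.
  Two curves that agree to first order at \<open>t\<close> thus have determinants with equal
  derivatives, and no invertibility enters.\<close>

lemma det_has_vector_derivative:
  fixes A :: "real \<Rightarrow> complex^'n^'n::finite"
  assumes "(A has_vector_derivative A') (at t)"
  shows "((\<lambda>u. det (A u)) has_vector_derivative
     (\<Sum>p | p permutes (UNIV::'n set). of_int (sign p) *
        (\<Sum>i\<in>UNIV. A' $ i $ p i * (\<Prod>j\<in>UNIV - {i}. A t $ j $ p j)))) (at t)"
proof -
  have entry: "((\<lambda>u. A u $ i $ j) has_derivative (\<lambda>h. h *\<^sub>R A' $ i $ j)) (at t)" for i j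
    using has_vector_derivative_vec_nth[OF has_vector_derivative_vec_nth[OF assms, of i], of j]
    by (simp add: has_vector_derivative_def)
  have "((\<lambda>u. \<Prod>i\<in>UNIV. A u $ i $ p i) has_vector_derivative
      (\<Sum>i\<in>UNIV. A' $ i $ p i * (\<Prod>j\<in>UNIV - {i}. A t $ j $ p j))) (at t)" for p :: "'n \<Rightarrow> 'n"
    unfolding has_vector_derivative_def
    by (rule has_derivative_eq_rhs, rule has_derivative_prod, rule entry)
      (simp add: scaleR_sum_right)
  then show ?thesis
    unfolding det_def
    by (intro derivative_intros has_vector_derivative_mult_right) auto
qed

text \<open>To first order in \<open>u - t\<close>, the curve \<open>M u\<close> agrees with the conjugate of \<open>M t\<close> by
  \<open>1 + (u - t) B\<close>, and the derivative of the determinant only sees the first order.\<close>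

lemma det_commutator_derivative:
  fixes M :: "real \<Rightarrow> complex^'n^'n::finite"
  assumes M: "(M has_vector_derivative (B ** M t - M t ** B)) (at t)"
  shows "((\<lambda>u. det (M u)) has_vector_derivative 0) (at t)"
proof -
  define C where "C u = mat 1 + (u - t) *\<^sub>R B" for u
  have C: "(C has_vector_derivative B) (at t)"
    unfolding C_def by (auto intro!: derivative_eq_intros)
  have Ct: "C t = mat 1" by (simp add: C_def)
  have mm: "bounded_bilinear (\<lambda>X Y :: complex^'n^'n. X ** Y)"
    unfolding bilinear_conv_bounded_bilinear[symmetric] bilinear_def
    by (auto intro!: linearI simp: matrix_add_ldistrib vec_eq_iff matrix_matrix_mult_def
        distrib_left distrib_right sum.distrib scaleR_sum_right)
  \<comment> \<open>M B + (B M - M B) = B M, so \<open>M u ** C u\<close> and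
    \<open>C u ** M t\<close> agree to first order at \<open>t\<close>.\<close>
  have R: "((\<lambda>u. M u ** C u) has_vector_derivative B ** M t) (at t)"
    using bounded_bilinear.has_vector_derivative[OF mm M C] by (simp add: Ct)
  have L: "((\<lambda>u. C u ** M t) has_vector_derivative B ** M t) (at t)"
    using bounded_bilinear.has_vector_derivative[OF mm C has_vector_derivative_const[of "M t"]] by simp
  obtain d e where d: "((\<lambda>u. det (M u)) has_vector_derivative d) (at t)"
    and e: "((\<lambda>u. det (C u)) has_vector_derivative e) (at t)"
    using det_has_vector_derivative[OF M] det_has_vector_derivative[OF C] by blast
  have "((\<lambda>u. det (M u ** C u)) has_vector_derivative det (M t) * e + d) (at t)"
    using has_vector_derivative_mult[OF d e] by (simp add: det_mul Ct)
  moreover have "((\<lambda>u. det (C u ** M t)) has_vector_derivative e * det (M t)) (at t)"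
    using has_vector_derivative_mult_left[OF e] by (simp add: det_mul)
  moreover obtain g where "((\<lambda>u. det (M u ** C u)) has_vector_derivative g) (at t)"
    and "((\<lambda>u. det (C u ** M t)) has_vector_derivative g) (at t)"
    using det_has_vector_derivative[OF R] det_has_vector_derivative[OF L] unfolding Ct by simp
  ultimately have "det (M t) * e + d = e * det (M t)"
    by (metis (no_types, lifting) vector_derivative_unique_at)
  then show ?thesis using d by (simp add: mult.commute)
qed

lemma constant_if_derivative_zero:
  fixes f :: "real \<Rightarrow> 'a::real_normed_vector"
  assumes "\<And>t. (f has_vector_derivative 0) (at t)"
  shows "f t = f u"
proof -
  obtain c where "\<And>t. t \<in> UNIV \<Longrightarrow> f t = c"
    by (rule has_vector_derivative_zero_constant[of UNIV f]) (use assms in auto)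
  then show ?thesis by simp
qed

text \<open>The curve \<open>M\<close> is only required locally, because spinors are chosen locally in time.\<close>

lemma isospectral_det_constant:
  fixes f :: "real \<Rightarrow> complex" and M :: "real \<Rightarrow> real \<Rightarrow> complex^'n^'n::finite"
  assumes "\<And>t. (M t has_vector_derivative (B t ** M t t - M t t ** B t)) (at t)"
    and "\<And>t. eventually (\<lambda>u. f u = det (M t u)) (nhds t)"
  shows "f t = f u"
proof -
  have "(f has_vector_derivative 0) (at t)" for t
  proof -
    have "eventually (\<lambda>u. f u = det (M t u)) (at t)"
      using assms(2)[of t] by (simp add: eventually_nhds_conv_at)
    moreover have "f t = det (M t t)"
      using assms(2)[of t] by (rule eventually_nhds_x_imp_x)
    ultimately show ?thesis
      using det_commutator_derivative[OF assms(1)[of t]] assms(2)[of t]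
        has_vector_derivative_cong_ev[of UNIV f "\<lambda>u. det (M t u)" t 0]
      by simp
  qed
  then show ?thesis by (rule constant_if_derivative_zero)
qed

text \<open>Together with \<open>L' = [B, L]\<close>, the relation \<open>X' = L + [B, X]\<close> makes \<open>X + (\<tau> - u) L\<close>
  isospectral; comparing the times \<open>0\<close> and \<open>\<tau>\<close> identifies the poles at time \<open>\<tau>\<close> with the eigenvalues
  of \<open>\<tau> L + X\<close> at time \<open>0\<close>.\<close>

lemma lax_pencil_commutator:
  fixes L :: "real \<Rightarrow> complex^'n^'n::finite" and x x' :: "real \<Rightarrow> 'n \<Rightarrow> complex"
  assumes L: "(L has_vector_derivative (B ** L t - L t ** B)) (at t)"
    and x: "\<And>j. ((\<lambda>u. x u j) has_vector_derivative L t $ j $ j) (at t)"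
    and LB: "\<And>j k. j \<noteq> k \<Longrightarrow> L t $ j $ k = B $ j $ k * (x t j - x t k)"
    and M: "\<And>u. M u = mat z - (\<tau> - u) *\<^sub>R L u - (\<chi> j k. if j = k then x u j else 0)"
  shows "(M has_vector_derivative (B ** M t - M t ** B)) (at t)"
proof -
  have X: "((\<lambda>u. \<chi> j k. if j = k then x u j else 0) has_vector_derivative
      (\<chi> j k. if j = k then L t $ j $ k else 0)) (at t)"
  proof -
    have "((\<lambda>u. if j = k then x u j else 0) has_vector_derivative
        (if j = k then L t $ j $ k else 0)) (at t)" for j k
      using x by auto
    then show ?thesis by (intro has_vector_derivative_vec) simp
  qed
  have "(M has_vector_derivative
      (L t - (\<tau> - t) *\<^sub>R (B ** L t - L t ** B) - (\<chi> j k. if j = k then L t $ j $ k else 0))) (at t)"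
    unfolding M by (auto intro!: derivative_eq_intros L X)
  moreover have "L t - (\<tau> - t) *\<^sub>R (B ** L t - L t ** B) - (\<chi> j k. if j = k then L t $ j $ k else 0)
      = B ** M t - M t ** B"
  proof (intro vec_eq_iff[THEN iffD2] allI)
    fix j k
    have Mlk: "M t $ l $ k = (if l = k then z - x t l else 0) - of_real (\<tau> - t) * L t $ l $ k" for l k
      by (simp add: M mat_def vector_scaleR_component) (simp add: scaleR_conv_of_real)
    define c :: complex where "c = of_real (\<tau> - t)"
    have "(\<Sum>l\<in>UNIV. B $ j $ l * M t $ l $ k)
        = (\<Sum>l\<in>UNIV. (if l = k then B $ j $ l * (z - x t l) else 0) - c * (B $ j $ l * L t $ l $ k))"
      unfolding Mlk c_def[symmetric] by (rule sum.cong) (auto simp: algebra_simps)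
    also have "\<dots> = B $ j $ k * (z - x t k) - c * (\<Sum>l\<in>UNIV. B $ j $ l * L t $ l $ k)"
      by (simp add: sum_subtractf sum_distrib_left)
    finally have 1: "(B ** M t) $ j $ k = B $ j $ k * (z - x t k) - c * (B ** L t) $ j $ k"
      by (simp add: matrix_matrix_mult_def)
    have "(\<Sum>l\<in>UNIV. M t $ j $ l * B $ l $ k)
        = (\<Sum>l\<in>UNIV. (if l = j then (z - x t l) * B $ l $ k else 0) - c * (L t $ j $ l * B $ l $ k))"
      unfolding Mlk c_def[symmetric] by (rule sum.cong) (auto simp: algebra_simps)
    also have "\<dots> = (z - x t j) * B $ j $ k - c * (\<Sum>l\<in>UNIV. L t $ j $ l * B $ l $ k)"
      by (simp add: sum_subtractf sum_distrib_left)
    finally have 2: "(M t ** B) $ j $ k = (z - x t j) * B $ j $ k - c * (L t ** B) $ j $ k"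
      by (simp add: matrix_matrix_mult_def)
    \<comment> \<open>On the diagonal, \<open>L t\<close> cancels against the velocities of the
      poles, and the commutator of \<open>B\<close> with the pole matrix vanishes; off the diagonal,
      \<open>LB\<close> says that this commutator is -L.\<close>
    show "(L t - (\<tau> - t) *\<^sub>R (B ** L t - L t ** B) - (\<chi> j k. if j = k then L t $ j $ k else 0)) $ j $ k
        = (B ** M t - M t ** B) $ j $ k"
      using LB[of j k] by (auto simp: 1 2 c_def algebra_simps vector_scaleR_component) (simp_all add: scaleR_conv_of_real algebra_simps)
  qed
  ultimately show ?thesis by simp
qed

section \<open>The Cauchy form\<close>

lemma sum_antisymmetric:
  fixes f :: "'n::finite \<Rightarrow> 'n \<Rightarrow> 'a::real_vector"
  assumes "\<And>j k. j \<noteq> k \<Longrightarrow> f j k = - f k j"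
  shows "(\<Sum>j\<in>UNIV. \<Sum>k\<in>UNIV - {j}. f j k) = 0"
proof -
  define g where "g j k = (if j = k then 0 else f j k)" for j k
  have g: "g j k = - g k j" for j k
    using assms[of j k] by (auto simp: g_def)
  have "(\<Sum>j\<in>UNIV. \<Sum>k\<in>UNIV - {j}. f j k) = (\<Sum>j\<in>UNIV. \<Sum>k\<in>UNIV. g j k)"
  proof (rule sum.cong[OF refl])
    fix j
    have "(\<Sum>k\<in>UNIV. g j k) = g j j + (\<Sum>k\<in>UNIV - {j}. g j k)"
      by (rule sum.remove) auto
    also have "\<dots> = (\<Sum>k\<in>UNIV - {j}. f j k)"
      by (auto simp: g_def intro!: sum.cong)
    finally show "(\<Sum>k\<in>UNIV - {j}. f j k) = (\<Sum>k\<in>UNIV. g j k)" by simp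
  qed
  moreover have "(\<Sum>j\<in>UNIV. \<Sum>k\<in>UNIV. g j k) = - (\<Sum>j\<in>UNIV. \<Sum>k\<in>UNIV. g j k)"
    by (subst sum.swap, subst g) (simp add: sum_negf)
  ultimately show ?thesis
    by (metis add.right_inverse real_vector.scale_eq_0_iff scaleR_2 zero_neq_numeral)
qed

text \<open>By residues, i / (x_k - cnj x_j) is 1/(2 \<pi>) times the L2 inner product on the real
  line of 1/(y - x_j) and 1/(y - x_k). The form is thus the inner product of the rational functions
  with residues \<open>a\<close> and \<open>b\<close>, conjugate-linear in the first.\<close>

definition cauchy_form :: "('n::finite \<Rightarrow> complex) \<Rightarrow> ('n \<Rightarrow> complex) \<Rightarrow> ('n \<Rightarrow> complex) \<Rightarrow> complex" where
  "cauchy_form x a b = (\<Sum>j\<in>UNIV. \<Sum>k\<in>UNIV. \<i> * cnj (a j) * b k / (x k - cnj (x j)))"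

lemma upper_half_plane_diff_cnj_nonzero:
  "Im z > 0 \<Longrightarrow> Im w > 0 \<Longrightarrow> z - cnj w \<noteq> 0"
  by (auto simp: complex_eq_iff)

text \<open>Multiplying by the Blaschke factor of the pole \<open>x n\<close> is the Schur complement step that
  eliminates the row and column \<open>n\<close> of the Cauchy matrix.\<close>

lemma cauchy_form_blaschke_le:
  assumes x: "\<And>j. Im (x j) > 0"
  shows "Re (cauchy_form x (\<lambda>k. a k * ((x k - x n) / (x k - cnj (x n))))
                           (\<lambda>k. a k * ((x k - x n) / (x k - cnj (x n)))))
    \<le> Re (cauchy_form x a a)"
proof -
  define b where "b k = (x k - x n) / (x k - cnj (x n))" for k
  define y where "y = Im (x n)"
  have y: "y > 0" using x by (simp add: y_def)
  \<comment> \<open>-w is the value at \<open>cnj (x n)\<close> of f(y) = \<Sum> a_k / (y - x_k).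
    Multiplying f by (y - x_n) / (y - cnj x_n) keeps its norm on the real line but creates a pole at
    \<open>cnj (x n)\<close>; the nonnegative remainder \<open>2 * y * (cmod w)\<^sup>2\<close> is
    the squared norm of that part, up to 2 \<pi>.\<close>
  define w where "w = (\<Sum>k\<in>UNIV. a k / (x k - cnj (x n)))"
  have nz: "x k - cnj (x j) \<noteq> 0" for j k
    using upper_half_plane_diff_cnj_nonzero[OF x x] .
  have nz': "cnj (x k) - x j \<noteq> 0" for j k
    using nz[of j k] by (metis right_minus_eq)
  have xn: "(x n - cnj (x n)) / \<i> = 2 * y"
    by (simp add: complex_eq_iff y_def Re_divide Im_divide)
  have key: "\<i> / (x k - cnj (x j))
     = \<i> * b k * cnj (b j) / (x k - cnj (x j))
       + 2 * y * (1 / (x k - cnj (x n))) * (1 / (cnj (x j) - x n))" for j k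
  proof -
    have "\<i> / (u - v) = \<i> * ((u - p) / (u - q)) * ((v - q) / (v - p)) / (u - v)
        + (p - q) / \<i> * (1 / (u - q)) * (1 / (v - p))"
      if "u - v \<noteq> 0" "u - q \<noteq> 0" "v - p \<noteq> 0" for u v q p :: complex
      using that by (simp add: divide_simps) (simp add: algebra_simps)
    from this[of "x k" "cnj (x j)" "cnj (x n)" "x n"]
    have "\<i> / (x k - cnj (x j)) = \<i> * ((x k - x n) / (x k - cnj (x n))) * ((cnj (x j) - cnj (x n)) / (cnj (x j) - x n))
        / (x k - cnj (x j)) + 2 * y * (1 / (x k - cnj (x n))) * (1 / (cnj (x j) - x n))"
      using nz[of k j] nz[of k n] nz'[of j n] unfolding xn by blast
    then show ?thesis by (simp add: b_def)
  qed
  have "cauchy_form x a a = (\<Sum>j\<in>UNIV. \<Sum>k\<in>UNIV. cnj (a j) * a k * (\<i> / (x k - cnj (x j))))"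
    unfolding cauchy_form_def by (intro sum.cong refl) (simp add: field_simps)
  also have "\<dots> = cauchy_form x (\<lambda>k. a k * b k) (\<lambda>k. a k * b k)
     + (\<Sum>j\<in>UNIV. \<Sum>k\<in>UNIV. 2 * y * (cnj (a j) / (cnj (x j) - x n)) * (a k / (x k - cnj (x n))))"
    unfolding cauchy_form_def sum.distrib[symmetric]
    by (intro sum.cong refl, subst key) (simp add: algebra_simps)
  also have "(\<Sum>j\<in>UNIV. \<Sum>k\<in>UNIV. 2 * y * (cnj (a j) / (cnj (x j) - x n)) * (a k / (x k - cnj (x n))))
     = 2 * y * (cnj w * w)"
  proof -
    have "cnj w = (\<Sum>j\<in>UNIV. cnj (a j) / (cnj (x j) - x n))" by (simp add: w_def)
    then have "cnj w * w = (\<Sum>j\<in>UNIV. \<Sum>k\<in>UNIV. (cnj (a j) / (cnj (x j) - x n)) * (a k / (x k - cnj (x n))))"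
      unfolding w_def by (simp only: sum_product)
    then show ?thesis by (simp only: sum_distrib_left mult.assoc)
  qed
  also have "cnj w * w = of_real ((cmod w)\<^sup>2)"
    by (metis complex_norm_square mult.commute)
  finally have "Re (cauchy_form x a a)
    = Re (cauchy_form x (\<lambda>k. a k * b k) (\<lambda>k. a k * b k)) + 2 * y * (cmod w)\<^sup>2"
    by (simp flip: of_real_power)
  then show ?thesis using y by (simp add: b_def)
qed

text \<open>Multiplying by the Blaschke factors of all poles except \<open>x j\<close>, one at a
  time, never increases the form. The product vanishes at those poles, so only the residue at
  \<open>x j\<close> survives, and 1 / (2 Im x_j) is the form of 1/(y - x_j).\<close>

lemma cauchy_form_ge:
  assumes x: "\<And>j. Im (x j) > 0"
  shows "(cmod (a j))\<^sup>2 * (\<Prod>n\<in>UNIV - {j}. (cmod (x j - x n) / cmod (x j - cnj (x n)))\<^sup>2)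
     / (2 * Im (x j)) \<le> Re (cauchy_form x a a)"
proof -
  define b where "b k n = (x k - x n) / (x k - cnj (x n))" for k n
  have "Re (cauchy_form x (\<lambda>k. a k * (\<Prod>n\<in>S. b k n)) (\<lambda>k. a k * (\<Prod>n\<in>S. b k n))) \<le> Re (cauchy_form x a a)"
    if "finite S" for S
    using that
  proof induction
    case (insert n S)
    have eq: "(\<lambda>k. a k * (\<Prod>n\<in>insert n S. b k n))
        = (\<lambda>k. a k * (\<Prod>n\<in>S. b k n) * ((x k - x n) / (x k - cnj (x n))))"
      using insert by (auto simp: b_def)
    show ?case
      unfolding eq using cauchy_form_blaschke_le[OF x, where a="\<lambda>k. a k * (\<Prod>n\<in>S. b k n)" and n=n] insert.IH
      by (rule order_trans)
  qed simp
  then have le: "Re (cauchy_form x (\<lambda>k. a k * (\<Prod>n\<in>UNIV - {j}. b k n)) (\<lambda>k. a k * (\<Prod>n\<in>UNIV - {j}. b k n)))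
      \<le> Re (cauchy_form x a a)" by simp
  define c where "c = a j * (\<Prod>n\<in>UNIV - {j}. b j n)"
  have eq: "(\<lambda>k. a k * (\<Prod>n\<in>UNIV - {j}. b k n)) = (\<lambda>k. if k = j then c else 0)"
    by (auto simp: fun_eq_iff c_def b_def[of _ "_"] intro!: prod_zero)
  have "cauchy_form x (\<lambda>k. if k = j then c else 0) (\<lambda>k. if k = j then c else 0)
     = (\<Sum>i\<in>UNIV. if i = j then \<i> * cnj c * c / (x j - cnj (x j)) else 0)"
    unfolding cauchy_form_def
  proof (rule sum.cong[OF refl])
    fix i
    have "(\<Sum>k\<in>UNIV. \<i> * cnj (if i = j then c else 0) * (if k = j then c else 0) / (x k - cnj (x i)))
       = (\<Sum>k\<in>UNIV. if k = j then \<i> * cnj (if i = j then c else 0) * c / (x j - cnj (x i)) else 0)"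
      by (intro sum.cong) auto
    then show "(\<Sum>k\<in>UNIV. \<i> * cnj (if i = j then c else 0) * (if k = j then c else 0) / (x k - cnj (x i)))
       = (if i = j then \<i> * cnj c * c / (x j - cnj (x j)) else 0)"
      by simp
  qed
  also have "\<dots> = \<i> * cnj c * c / (x j - cnj (x j))" by simp
  also have "x j - cnj (x j) = \<i> * (2 * Im (x j))"
    by (simp add: complex_eq_iff)
  also have "\<i> * cnj c * c = \<i> * of_real ((cmod c)\<^sup>2)"
    by (metis complex_norm_square mult.commute mult.assoc)
  also have "\<i> * of_real ((cmod c)\<^sup>2) / (\<i> * (2 * Im (x j))) = of_real ((cmod c)\<^sup>2 / (2 * Im (x j)))"
    by simp
  finally have "Re (cauchy_form x (\<lambda>k. if k = j then c else 0) (\<lambda>k. if k = j then c else 0))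
     = (cmod c)\<^sup>2 / (2 * Im (x j))" by simp
  moreover have "(cmod c)\<^sup>2 = (cmod (a j))\<^sup>2 * (\<Prod>n\<in>UNIV - {j}. (cmod (x j - x n) / cmod (x j - cnj (x n)))\<^sup>2)"
    by (simp add: c_def b_def norm_mult norm_divide power_mult_distrib prod_norm[symmetric] prod_power_distrib)
  ultimately show ?thesis using le unfolding eq by simp
qed

section \<open>Spinors of null vectors\<close>

text \<open>The traceless matrix \<open>s \<cdot> \<sigma>\<close> (called \<open>pauli s\<close> below) of a null vector \<open>s\<close> has rank one; a
  factorization is a column \<open>\<psi>\<close> times a row \<open>\<phi>\<close>, unique up to \<open>(c \<psi>, \<phi> / c)\<close>.\<close>

definition spinor_factors :: "complex^3 \<Rightarrow> complex^2 \<Rightarrow> complex^2 \<Rightarrow> bool" where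
  "spinor_factors s \<psi> \<phi> \<longleftrightarrow>
     s $ 3 = \<psi> $ 1 * \<phi> $ 1 \<and> - s $ 3 = \<psi> $ 2 * \<phi> $ 2 \<and>
     s $ 1 - \<i> * s $ 2 = \<psi> $ 1 * \<phi> $ 2 \<and> s $ 1 + \<i> * s $ 2 = \<psi> $ 2 * \<phi> $ 1"

lemma spinor_factors_entries:
  assumes "spinor_factors s \<psi> \<phi>"
  shows "s $ 3 = \<psi> $ 1 * \<phi> $ 1" "- s $ 3 = \<psi> $ 2 * \<phi> $ 2"
    "s $ 1 - \<i> * s $ 2 = \<psi> $ 1 * \<phi> $ 2" "s $ 1 + \<i> * s $ 2 = \<psi> $ 2 * \<phi> $ 1"
  using assms unfolding spinor_factors_def by blast+

definition spinor_pair :: "complex^2 \<Rightarrow> complex^2 \<Rightarrow> complex" where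
  "spinor_pair \<phi> \<psi> = \<phi> $ 1 * \<psi> $ 1 + \<phi> $ 2 * \<psi> $ 2"

definition pauli :: "complex^3 \<Rightarrow> complex^2^2" where
  "pauli d = vector [vector [d $ 3, d $ 1 - \<i> * d $ 2], vector [d $ 1 + \<i> * d $ 2, - d $ 3]]"

lemma pauli_mult_vec:
  "(pauli d *v \<psi>) $ 1 = d $ 3 * \<psi> $ 1 + (d $ 1 - \<i> * d $ 2) * \<psi> $ 2"
  "(pauli d *v \<psi>) $ 2 = (d $ 1 + \<i> * d $ 2) * \<psi> $ 1 - d $ 3 * \<psi> $ 2"
  by (simp_all add: pauli_def matrix_vector_mult_def sum_2)

lemma spinor_pair_self:
  "spinor_factors s \<psi> \<phi> \<Longrightarrow> spinor_pair \<phi> \<psi> = 0"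
  unfolding spinor_pair_def by (metis add.right_inverse mult.commute spinor_factors_entries(1,2))

lemma spinor_pair_pauli:
  assumes "spinor_factors s \<psi> \<phi>"
  shows "spinor_pair \<phi>' (pauli s *v \<psi>') = spinor_pair \<phi>' \<psi> * spinor_pair \<phi> \<psi>'"
proof -
  have "spinor_pair \<phi>' (pauli s *v \<psi>') = \<phi>' $ 1 * (s $ 3 * \<psi>' $ 1 + (s $ 1 - \<i> * s $ 2) * \<psi>' $ 2)
     + \<phi>' $ 2 * ((s $ 1 + \<i> * s $ 2) * \<psi>' $ 1 + (- s $ 3) * \<psi>' $ 2)"
    by (simp add: spinor_pair_def pauli_mult_vec)
  also have "\<dots> = \<phi>' $ 1 * (\<psi> $ 1 * \<phi> $ 1 * \<psi>' $ 1 + \<psi> $ 1 * \<phi> $ 2 * \<psi>' $ 2)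
     + \<phi>' $ 2 * (\<psi> $ 2 * \<phi> $ 1 * \<psi>' $ 1 + \<psi> $ 2 * \<phi> $ 2 * \<psi>' $ 2)"
    using assms unfolding spinor_factors_def by metis
  finally show ?thesis by (simp add: spinor_pair_def algebra_simps)
qed

lemma pauli_sum_mult_vec:
  "pauli (\<Sum>k\<in>S. c k *s d k) *v \<psi> = (\<Sum>k\<in>S. c k *s (pauli (d k) *v \<psi>))"
proof (induction S rule: infinite_finite_induct)
  case (insert k S)
  have "pauli (a *s v + u) *v \<psi> = a *s (pauli v *v \<psi>) + pauli u *v \<psi>" for u v a
    by (simp add: vec_eq_iff forall_2 pauli_mult_vec algebra_simps)
  with insert show ?case by simp
qed (simp_all add: vec_eq_iff forall_2 pauli_mult_vec)

lemma spinor_pair_sum: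
  "spinor_pair \<phi> (\<Sum>k\<in>S. c k *s d k) = (\<Sum>k\<in>S. c k * spinor_pair \<phi> (d k))"
  by (induction S rule: infinite_finite_induct) (simp_all add: spinor_pair_def distrib_left mult.left_commute)

text \<open>The left side is the trace of \<open>pauli s ** pauli s'\<close>, which splits for
  rank-one factors. The entries (j,k) and (k,j) of \<open>spinor_pair\<close> therefore multiply to
  2 s_j . s_k without any square root.\<close>

lemma cdot_spinor_factors:
  assumes "spinor_factors s \<psi> \<phi>" "spinor_factors s' \<psi>' \<phi>'"
  shows "2 * cdot s s' = spinor_pair \<phi> \<psi>' * spinor_pair \<phi>' \<psi>"
proof -
  have "2 * cdot s s' = (s $ 1 - \<i> * s $ 2) * (s' $ 1 + \<i> * s' $ 2)
      + (s $ 1 + \<i> * s $ 2) * (s' $ 1 - \<i> * s' $ 2) + s $ 3 * s' $ 3 + (- s $ 3) * (- s' $ 3)"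
    by (simp add: cdot_def sum_3 algebra_simps)
  also have "\<dots> = \<psi> $ 1 * \<phi> $ 2 * (\<psi>' $ 2 * \<phi>' $ 1) + \<psi> $ 2 * \<phi> $ 1 * (\<psi>' $ 1 * \<phi>' $ 2)
     + \<psi> $ 1 * \<phi> $ 1 * (\<psi>' $ 1 * \<phi>' $ 1) + \<psi> $ 2 * \<phi> $ 2 * (\<psi>' $ 2 * \<phi>' $ 2)"
    using assms unfolding spinor_factors_def by metis
  finally show ?thesis by (simp add: spinor_pair_def algebra_simps)
qed

section \<open>Existence of spinor factorizations in two charts\<close>

lemma null_vector_eq:
  assumes "cdot s s = 0"
  shows "(s $ 1 - \<i> * s $ 2) * (s $ 1 + \<i> * s $ 2) = - (s $ 3 * s $ 3)"
proof -
  have "(s $ 1 - \<i> * s $ 2) * (s $ 1 + \<i> * s $ 2) = s $ 1 * s $ 1 + s $ 2 * s $ 2"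
    by (simp add: algebra_simps)
  then show ?thesis
    using assms unfolding cdot_def sum_3 by (metis eq_neg_iff_add_eq_0)
qed

lemma null_vector_cases:
  assumes "cdot s s = 0" "s \<noteq> 0"
  obtains "s $ 1 + \<i> * s $ 2 \<noteq> 0" | "s $ 1 - \<i> * s $ 2 \<noteq> 0"
proof -
  have "s = 0" if "s $ 1 + \<i> * s $ 2 = 0" "s $ 1 - \<i> * s $ 2 = 0"
  proof -
    have "s $ 3 = 0" using null_vector_eq[OF assms(1)] that by simp
    moreover have "2 * s $ 1 = 0" using that by (metis add.commute diff_add_cancel add_eq_0_iff eq_iff_diff_eq_0 mult_2 add.right_neutral)
    moreover have "s $ 2 = 0" using that calculation by simp
    ultimately show ?thesis by (simp add: vec_eq_iff forall_3)
  qed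
  then show ?thesis using that assms(2) by blast
qed

text \<open>\<psi> is the first column of \<open>pauli s\<close>, and in the companion lemma for the
  upper entry it is the second one. A nonzero null vector lies in at least one chart, since
  \<open>pauli s\<close> cannot have both off-diagonal entries zero.\<close>

lemma spinor_factors_lower:
  assumes "cdot s s = 0" "s $ 1 + \<i> * s $ 2 \<noteq> 0"
  shows "spinor_factors s (vector [s $ 3, s $ 1 + \<i> * s $ 2]) (vector [1, - (s $ 3 / (s $ 1 + \<i> * s $ 2))])"
  using eq_divide_imp[OF assms(2) null_vector_eq[OF assms(1)]] assms(2)
  by (simp add: spinor_factors_def)

lemma spinor_factors_upper:
  assumes "cdot s s = 0" "s $ 1 - \<i> * s $ 2 \<noteq> 0"
  shows "spinor_factors s (vector [s $ 1 - \<i> * s $ 2, - s $ 3]) (vector [s $ 3 / (s $ 1 - \<i> * s $ 2), 1])"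
  using eq_divide_imp[OF assms(2), of "s $ 1 + \<i> * s $ 2" "- (s $ 3 * s $ 3)"] null_vector_eq[OF assms(1)] assms(2)
  by (simp add: spinor_factors_def mult.commute)

lemma spinor_factors_exist:
  assumes "cdot s s = 0" "s \<noteq> 0"
  shows "\<exists>\<psi> \<phi>. spinor_factors s \<psi> \<phi>"
  using null_vector_cases[OF assms]
  by cases (blast intro: spinor_factors_lower[OF assms(1)] spinor_factors_upper[OF assms(1)])+

section \<open>Spinors along a moving spin\<close>

lemma differentiable_vec2:
  fixes f g :: "real \<Rightarrow> complex"
  assumes "f differentiable (at t)" "g differentiable (at t)"
  shows "(\<lambda>u. vector [f u, g u] :: complex^2) differentiable (at t)"
proof -
  obtain f' g' where fg: "(f has_vector_derivative f') (at t)" "(g has_vector_derivative g') (at t)"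
    using assms unfolding vector_derivative_works by blast
  have "((\<lambda>u. vector [f u, g u] :: complex^2) has_vector_derivative vector [f', g']) (at t)"
  proof (intro has_vector_derivative_vec)
    fix i :: 2
    show "((\<lambda>u. (vector [f u, g u] :: complex^2) $ i) has_vector_derivative (vector [f', g'] :: complex^2) $ i) (at t)"
      using exhaust_2[of i] fg by auto
  qed
  then show ?thesis by (rule differentiableI_vector)
qed

lemma spinor_factors_smooth:
  assumes s: "(s has_vector_derivative s') (at t)"
    and null: "\<And>u. cdot (s u) (s u) = 0" and nz: "s t \<noteq> 0"
  obtains \<psi> \<phi> where "eventually (\<lambda>u. spinor_factors (s u) (\<psi> u) (\<phi> u)) (nhds t)"
    "\<psi> differentiable (at t)" "\<phi> differentiable (at t)"
proof -
  have d: "(\<lambda>u. s u $ i) differentiable (at t)" for i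
    using has_vector_derivative_vec_nth[OF s] by (rule differentiableI_vector)
  have ev: "eventually (\<lambda>u. f u \<noteq> 0) (nhds t)" if "f differentiable (at t)" "f t \<noteq> 0" for f :: "real \<Rightarrow> complex"
  proof -
    have "isCont f t" using that(1) by (rule differentiable_imp_continuous_within)
    then have "(f \<longlongrightarrow> f t) (nhds t)" by (simp add: isCont_def tendsto_nhds_iff)
    then show ?thesis using that(2) by (rule tendsto_imp_eventually_ne)
  qed
  from null_vector_cases[OF null nz] show ?thesis
  proof cases
    case 1
    show ?thesis
    proof (rule that)
      show "eventually (\<lambda>u. spinor_factors (s u) (vector [s u $ 3, s u $ 1 + \<i> * s u $ 2])
          (vector [1, - (s u $ 3 / (s u $ 1 + \<i> * s u $ 2))])) (nhds t)"
        using ev[where f="\<lambda>u. s u $ 1 + \<i> * s u $ 2"] 1 d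
        by (auto intro!: spinor_factors_lower null elim!: eventually_mono)
    qed (auto intro!: differentiable_vec2 derivative_intros d 1)
  next
    case 2
    show ?thesis
    proof (rule that)
      show "eventually (\<lambda>u. spinor_factors (s u) (vector [s u $ 1 - \<i> * s u $ 2, - s u $ 3])
          (vector [s u $ 3 / (s u $ 1 - \<i> * s u $ 2), 1])) (nhds t)"
        using ev[where f="\<lambda>u. s u $ 1 - \<i> * s u $ 2"] 2 d
        by (auto intro!: spinor_factors_upper null elim!: eventually_mono)
    qed (auto intro!: differentiable_vec2 derivative_intros d 2)
  qed
qed

lemma spinor_factors_nonzero:
  assumes "spinor_factors s \<psi> \<phi>" "s \<noteq> 0"
  obtains i j where "\<psi> $ i \<noteq> 0" "\<phi> $ j \<noteq> 0"
proof -
  have "s = 0" if "\<psi> = 0 \<or> \<phi> = 0"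
  proof -
    have "s $ 3 = 0" "s $ 1 - \<i> * s $ 2 = 0" "s $ 1 + \<i> * s $ 2 = 0"
      using assms(1) that by (auto simp: spinor_factors_def)
    moreover from this have "cdot s s = 0"
      by (simp add: cdot_def sum_3 add_eq_0_iff)
    ultimately show ?thesis by (metis null_vector_cases)
  qed
  then show ?thesis using that assms(2) by (auto simp: vec_eq_iff)
qed

lemma spinor_factors_unique:
  assumes "spinor_factors s \<psi> \<phi>" "spinor_factors s \<psi>' \<phi>'" "s \<noteq> 0"
  obtains c where "c \<noteq> 0" "\<psi>' = c *s \<psi>" "\<phi> = c *s \<phi>'"
proof -
  have e: "\<psi> $ i * \<phi> $ j = \<psi>' $ i * \<phi>' $ j" for i j
    using assms(1,2) exhaust_2[of i] exhaust_2[of j] unfolding spinor_factors_def by metis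
  obtain i j where ij: "\<psi> $ i \<noteq> 0" "\<phi> $ j \<noteq> 0"
    using spinor_factors_nonzero[OF assms(1,3)] .
  then have ij': "\<psi>' $ i \<noteq> 0" "\<phi>' $ j \<noteq> 0" using e[of i j] by auto
  show ?thesis
  proof (rule that)
    show "\<phi> $ j / \<phi>' $ j \<noteq> 0" using ij ij' by simp
    show "\<psi>' = (\<phi> $ j / \<phi>' $ j) *s \<psi>"
      using e[of _ j] ij' by (simp add: vec_eq_iff field_simps)
    have r: "\<phi> $ j / \<phi>' $ j = \<psi>' $ i / \<psi> $ i" using e[of i j] ij ij' by (simp add: field_simps)
    show "\<phi> = (\<phi> $ j / \<phi>' $ j) *s \<phi>'"
      unfolding r using e[of i] ij(1) by (simp add: vec_eq_iff field_simps)
  qed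
qed

text \<open>Writing S and D for \<open>pauli (s t)\<close> and \<open>pauli d\<close>, the evolution
  of the spin is S' = S D - D S. For S = \<psi> \<phi> this splits into -D \<psi> and \<phi> D, up
  to the rate g of the rescaling (c \<psi>, \<phi> / c) that the factorization leaves free. The row
  \<phi>' is described by its pairings.\<close>

lemma spinor_factors_derivative:
  assumes ev: "eventually (\<lambda>u. spinor_factors (s u) (\<psi> u) (\<phi> u)) (nhds t)"
    and \<psi>: "(\<psi> has_vector_derivative \<psi>') (at t)" and \<phi>: "(\<phi> has_vector_derivative \<phi>') (at t)"
    and s: "(s has_vector_derivative (2 * \<i>) *s ccross (s t) d) (at t)"
    and nz: "s t \<noteq> 0"
  obtains g where "\<psi>' = g *s \<psi> t - pauli d *v \<psi> t" "\<And>\<eta>. spinor_pair \<phi>' \<eta> = spinor_pair (\<phi> t) (pauli d *v \<eta>) - g * spinor_pair (\<phi> t) \<eta>"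
proof -
  \<comment> \<open>\<open>P\<close> and \<open>Q\<close> are the deviations from the solution with
    g = 0. The product rule gives \<psi> Q + P \<phi> = 0 in all four entries, which forces P = g
    \<psi> and Q = -g \<phi> with one common g.\<close>
  define P where "P = \<psi>' + pauli d *v \<psi> t"
  define Q where "Q = \<phi>' - vector [\<phi> t $ 1 * d $ 3 + \<phi> t $ 2 * (d $ 1 + \<i> * d $ 2),
      \<phi> t $ 1 * (d $ 1 - \<i> * d $ 2) - \<phi> t $ 2 * d $ 3]"
  have f: "spinor_factors (s t) (\<psi> t) (\<phi> t)"
    using ev by (rule eventually_nhds_x_imp_x)
  have prod: "((\<lambda>u. \<psi> u $ i * \<phi> u $ j) has_vector_derivative \<psi> t $ i * \<phi>' $ j + \<psi>' $ i * \<phi> t $ j) (at t)" for i j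
    by (rule has_vector_derivative_mult has_vector_derivative_vec_nth \<psi> \<phi>)+
  have unique: "\<psi> t $ i * \<phi>' $ j + \<psi>' $ i * \<phi> t $ j = h'"
    if "(h has_vector_derivative h') (at t)" "\<And>u. spinor_factors (s u) (\<psi> u) (\<phi> u) \<Longrightarrow> h u = \<psi> u $ i * \<phi> u $ j"
    for h h' i j
  proof (rule vector_derivative_unique_at[OF prod])
    have "eventually (\<lambda>u. u \<in> UNIV \<longrightarrow> h u = \<psi> u $ i * \<phi> u $ j) (nhds t)"
      using ev by eventually_elim (simp add: that(2))
    then show "((\<lambda>u. \<psi> u $ i * \<phi> u $ j) has_vector_derivative h') (at t)"
      using has_vector_derivative_cong_ev[of UNIV h "\<lambda>u. \<psi> u $ i * \<phi> u $ j" t h'] that(1) that(2)[OF f] by simp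
  qed
  note s_i = has_vector_derivative_vec_nth[OF s]
  define w where "w = s t"
  have sd: "((\<lambda>u. s u $ 3) has_vector_derivative 2 * \<i> * (w $ 1 * d $ 2 - w $ 2 * d $ 1)) (at t)"
    "((\<lambda>u. - s u $ 3) has_vector_derivative - (2 * \<i> * (w $ 1 * d $ 2 - w $ 2 * d $ 1))) (at t)"
    "((\<lambda>u. s u $ 1 - \<i> * s u $ 2) has_vector_derivative
       2 * \<i> * (w $ 2 * d $ 3 - w $ 3 * d $ 2) - \<i> * (2 * \<i> * (w $ 3 * d $ 1 - w $ 1 * d $ 3))) (at t)"
    "((\<lambda>u. s u $ 1 + \<i> * s u $ 2) has_vector_derivative
       2 * \<i> * (w $ 2 * d $ 3 - w $ 3 * d $ 2) + \<i> * (2 * \<i> * (w $ 3 * d $ 1 - w $ 1 * d $ 3))) (at t)"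
    using s_i[of 1] s_i[of 2] s_i[of 3]
    by (auto simp: ccross_def w_def intro!: has_vector_derivative_add has_vector_derivative_diff
        has_vector_derivative_minus has_vector_derivative_mult_right)
  have e: "w $ 3 = \<psi> t $ 1 * \<phi> t $ 1" "- w $ 3 = \<psi> t $ 2 * \<phi> t $ 2"
     "w $ 1 - \<i> * w $ 2 = \<psi> t $ 1 * \<phi> t $ 2" "w $ 1 + \<i> * w $ 2 = \<psi> t $ 2 * \<phi> t $ 1"
    unfolding w_def by (rule spinor_factors_entries[OF f])+
  have "\<psi> t $ 1 * Q $ 1 + P $ 1 * \<phi> t $ 1 = 0"
  proof -
    have U: "\<psi> t $ 1 * \<phi>' $ 1 + \<psi>' $ 1 * \<phi> t $ 1 = 2 * \<i> * (w $ 1 * d $ 2 - w $ 2 * d $ 1)"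
      by (rule unique[OF sd(1)]) (rule spinor_factors_entries)
    have "\<psi> t $ 1 * Q $ 1 + P $ 1 * \<phi> t $ 1
        = (\<psi> t $ 1 * \<phi>' $ 1 + \<psi>' $ 1 * \<phi> t $ 1) - (\<psi> t $ 1 * \<phi> t $ 2) * (d $ 1 + \<i> * d $ 2) + (d $ 1 - \<i> * d $ 2) * (\<psi> t $ 2 * \<phi> t $ 1)"
      by (simp add: P_def Q_def pauli_mult_vec algebra_simps)
    also have "\<dots> = 0"
      unfolding U e[symmetric]
      by (simp add: algebra_simps)
    finally show ?thesis .
  qed
  moreover have "\<psi> t $ 2 * Q $ 2 + P $ 2 * \<phi> t $ 2 = 0"
  proof -
    have U: "\<psi> t $ 2 * \<phi>' $ 2 + \<psi>' $ 2 * \<phi> t $ 2 = - (2 * \<i> * (w $ 1 * d $ 2 - w $ 2 * d $ 1))"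
      by (rule unique[OF sd(2)]) (rule spinor_factors_entries)
    have "\<psi> t $ 2 * Q $ 2 + P $ 2 * \<phi> t $ 2
        = (\<psi> t $ 2 * \<phi>' $ 2 + \<psi>' $ 2 * \<phi> t $ 2) - (\<psi> t $ 2 * \<phi> t $ 1) * (d $ 1 - \<i> * d $ 2) + (d $ 1 + \<i> * d $ 2) * (\<psi> t $ 1 * \<phi> t $ 2)"
      by (simp add: P_def Q_def pauli_mult_vec algebra_simps)
    also have "\<dots> = 0"
      unfolding U e[symmetric]
      by (simp add: algebra_simps)
    finally show ?thesis .
  qed
  moreover have "\<psi> t $ 1 * Q $ 2 + P $ 1 * \<phi> t $ 2 = 0"
  proof -
    have U: "\<psi> t $ 1 * \<phi>' $ 2 + \<psi>' $ 1 * \<phi> t $ 2 = 2 * \<i> * (w $ 2 * d $ 3 - w $ 3 * d $ 2) - \<i> * (2 * \<i> * (w $ 3 * d $ 1 - w $ 1 * d $ 3))"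
      by (rule unique[OF sd(3)]) (rule spinor_factors_entries)
    have "\<psi> t $ 1 * Q $ 2 + P $ 1 * \<phi> t $ 2
        = (\<psi> t $ 1 * \<phi>' $ 2 + \<psi>' $ 1 * \<phi> t $ 2) + 2 * d $ 3 * (\<psi> t $ 1 * \<phi> t $ 2) + (d $ 1 - \<i> * d $ 2) * ((\<psi> t $ 2 * \<phi> t $ 2) - (\<psi> t $ 1 * \<phi> t $ 1))"
      by (simp add: P_def Q_def pauli_mult_vec algebra_simps)
    also have "\<dots> = 0"
      unfolding U e[symmetric]
      by (simp add: algebra_simps)
    finally show ?thesis .
  qed
  moreover have "\<psi> t $ 2 * Q $ 1 + P $ 2 * \<phi> t $ 1 = 0"
  proof -
    have U: "\<psi> t $ 2 * \<phi>' $ 1 + \<psi>' $ 2 * \<phi> t $ 1 = 2 * \<i> * (w $ 2 * d $ 3 - w $ 3 * d $ 2) + \<i> * (2 * \<i> * (w $ 3 * d $ 1 - w $ 1 * d $ 3))"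
      by (rule unique[OF sd(4)]) (rule spinor_factors_entries)
    have "\<psi> t $ 2 * Q $ 1 + P $ 2 * \<phi> t $ 1
        = (\<psi> t $ 2 * \<phi>' $ 1 + \<psi>' $ 2 * \<phi> t $ 1) - 2 * d $ 3 * (\<psi> t $ 2 * \<phi> t $ 1) + (d $ 1 + \<i> * d $ 2) * ((\<psi> t $ 1 * \<phi> t $ 1) - (\<psi> t $ 2 * \<phi> t $ 2))"
      by (simp add: P_def Q_def pauli_mult_vec algebra_simps)
    also have "\<dots> = 0"
      unfolding U e[symmetric]
      by (simp add: algebra_simps)
    finally show ?thesis .
  qed
  ultimately have PQ: "\<psi> t $ i * Q $ j + P $ i * \<phi> t $ j = 0" for i j
    using exhaust_2[of i] exhaust_2[of j] by auto
  have "\<exists>i j. \<psi> t $ i \<noteq> 0 \<and> \<phi> t $ j \<noteq> 0"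
    using spinor_factors_nonzero[OF f nz] by auto
  then obtain i j where ij: "\<psi> t $ i \<noteq> 0" "\<phi> t $ j \<noteq> 0" by blast
  define g where "g = P $ i / \<psi> t $ i"
  have Q: "Q $ k = - g * \<phi> t $ k" for k
  proof -
    have "\<psi> t $ i * Q $ k = - (P $ i * \<phi> t $ k)"
      using PQ[of i k] by (rule eq_neg_iff_add_eq_0[THEN iffD2])
    then show ?thesis using ij(1) by (simp add: g_def field_simps)
  qed
  have P: "P $ k = g * \<psi> t $ k" for k
  proof -
    have "P $ k * \<phi> t $ j = g * \<psi> t $ k * \<phi> t $ j"
      using PQ[of k j] unfolding Q by (simp add: algebra_simps)
    then show ?thesis using ij(2) by simp
  qed
  show ?thesis
  proof (rule that)
    show "\<psi>' = g *s \<psi> t - pauli d *v \<psi> t"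
      using P by (simp add: P_def vec_eq_iff eq_diff_eq)
    have \<phi>': "\<phi>' $ 1 = \<phi> t $ 1 * d $ 3 + \<phi> t $ 2 * (d $ 1 + \<i> * d $ 2) - g * \<phi> t $ 1"
      "\<phi>' $ 2 = \<phi> t $ 1 * (d $ 1 - \<i> * d $ 2) - \<phi> t $ 2 * d $ 3 - g * \<phi> t $ 2"
      using Q[of 1] Q[of 2] by (simp_all add: Q_def algebra_simps)
    show "spinor_pair \<phi>' \<eta> = spinor_pair (\<phi> t) (pauli d *v \<eta>) - g * spinor_pair (\<phi> t) \<eta>" for \<eta>
      unfolding spinor_pair_def pauli_mult_vec \<phi>' by (simp add: algebra_simps)
  qed
qed

section \<open>The Lax matrix in terms of spinors\<close>

lemma has_vector_derivative_divide:
  fixes f g :: "real \<Rightarrow> 'a::real_normed_field"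
  assumes "(f has_vector_derivative f') (at t)" "(g has_vector_derivative g') (at t)" "g t \<noteq> 0"
  shows "((\<lambda>u. f u / g u) has_vector_derivative f' / g t - f t * g' / (g t * g t)) (at t)"
  using has_derivative_divide'[OF assms(1,2)[unfolded has_vector_derivative_def] assms(3)]
  unfolding has_vector_derivative_def
  by (rule has_derivative_eq_rhs) (simp add: assms(3) fun_eq_iff scaleR_conv_of_real right_diff_distrib diff_divide_distrib)

text \<open>The entries \<open>spinor_pair (\<phi> j) (\<psi> k)\<close> play the role of \<open>\<epsilon>\<^sub>j\<^sub>k \<surd>(2 s\<^sub>j \<cdot> s\<^sub>k)\<close>, without the choice of
  square roots; rescaling the spinors conjugates the matrix by a diagonal one.\<close>

definition spin_lax :: "complex \<Rightarrow> ('n \<Rightarrow> complex^2) \<Rightarrow> ('n \<Rightarrow> complex^2) \<Rightarrow> ('n \<Rightarrow> complex) \<Rightarrow> ('n \<Rightarrow> complex)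
    \<Rightarrow> complex^'n^'n::finite" where
  "spin_lax \<alpha> \<psi> \<phi> x x' = (\<chi> j k. if j = k then x' j else \<alpha> * spinor_pair (\<phi> j) (\<psi> k) / (x j - x k))"

lemma ccross_sum_right:
  "ccross u (\<Sum>k\<in>S. c k *s v k) = (\<Sum>k\<in>S. c k *s ccross u (v k))"
  by (induction S rule: infinite_finite_induct)
    (simp_all add: ccross_def vec_eq_iff forall_3 algebra_simps)

text \<open>The diagonal matrix \<open>E\<close> of the scale factors commutes with the pole matrix,
  so it conjugates the whole pencil. This makes the determinant independent of the spinors and
  allows a different smooth choice near each time.\<close>

lemma spin_lax_det_gauge:
  fixes s :: "'n::finite \<Rightarrow> complex^3"
  assumes "\<And>j. spinor_factors (s j) (\<psi> j) (\<phi> j)" "\<And>j. spinor_factors (s j) (\<psi>' j) (\<phi>' j)" "\<And>j. s j \<noteq> 0"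
  shows "det (mat z - a *\<^sub>R spin_lax \<alpha> \<psi> \<phi> x x' - (\<chi> j k. if j = k then x j else 0))
       = det (mat z - a *\<^sub>R spin_lax \<alpha> \<psi>' \<phi>' x x' - (\<chi> j k. if j = k then x j else 0))"
    (is "det ?M = det ?M'")
proof -
  define scale where "scale j c \<longleftrightarrow> c \<noteq> 0 \<and> \<psi>' j = c *s \<psi> j \<and> \<phi> j = c *s \<phi>' j" for j c
  have "\<exists>c. scale j c" for j
    by (rule spinor_factors_unique[OF assms(1,2,3), of j]) (unfold scale_def, blast)
  then obtain c where "\<And>j. scale j (c j)" by metis
  then have c: "c j \<noteq> 0" "\<psi>' j = c j *s \<psi> j" "\<phi> j = c j *s \<phi>' j" for j
    unfolding scale_def by blast+
  define E :: "complex^'n^'n" where "E = (\<chi> j k. if j = k then c j else 0)"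
  have pair: "c j * spinor_pair (\<phi>' j) (\<psi>' k) = spinor_pair (\<phi> j) (\<psi> k) * c k" for j k
    unfolding c(2)[of k] c(3)[of j] by (simp add: spinor_pair_def algebra_simps)
  have "E ** ?M' = ?M ** E"
  proof (intro vec_eq_iff[THEN iffD2] allI)
    fix j k
    have "(E ** ?M') $ j $ k = (\<Sum>l\<in>UNIV. if l = j then c j * ?M' $ l $ k else 0)"
      unfolding matrix_matrix_mult_def E_def vec_lambda_beta by (rule sum.cong) auto
    also have "\<dots> = c j * ?M' $ j $ k" by simp
    also have "\<dots> = ?M $ j $ k * c k"
    proof (cases "j = k")
      case False
      have "c j * ?M' $ j $ k = - (a *\<^sub>R (\<alpha> * (c j * spinor_pair (\<phi>' j) (\<psi>' k)) / (x j - x k)))"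
        using False by (simp add: mat_def spin_lax_def vector_scaleR_component)
      also have "\<dots> = ?M $ j $ k * c k"
        unfolding pair using False by (simp add: mat_def spin_lax_def vector_scaleR_component)
      finally show ?thesis .
    qed (simp add: mat_def spin_lax_def vector_scaleR_component)
    also have "\<dots> = (\<Sum>l\<in>UNIV. if l = k then ?M $ j $ l * c k else 0)" by simp
    also have "\<dots> = (?M ** E) $ j $ k"
      unfolding matrix_matrix_mult_def E_def vec_lambda_beta by (rule sum.cong) auto
    finally show "(E ** ?M') $ j $ k = (?M ** E) $ j $ k" .
  qed
  then have "det (E ** ?M') = det (?M ** E)" by (rule arg_cong)
  then have "det E * det ?M' = det E * det ?M" by (simp only: det_mul mult.commute)
  moreover have "det E = (\<Prod>j\<in>UNIV. c j)"
    by (subst det_diagonal) (auto simp: E_def)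
  then have "det E \<noteq> 0" using c(1) by (simp add: prod_zero_iff)
  ultimately have "det ?M' = det ?M" by (rule mult_left_cancel[THEN iffD1, rotated])
  then show ?thesis by (rule sym)
qed

text \<open>The entries p_jl p_lk match by (1/v^2 - 1/w^2) / (v + w) = 1/(v^2 w) - 1/(v w^2) with v
  = x_j - x_l and w = x_l - x_k, and p_jj = 0 disposes of the terms with l = j or l = k. The second
  conclusion is what the pencil argument requires of \<open>B\<close>.\<close>

lemma spin_lax_derivative:
  fixes s :: "real \<Rightarrow> 'n::finite \<Rightarrow> complex^3" and x x' :: "real \<Rightarrow> 'n \<Rightarrow> complex"
  assumes \<sigma>: "\<sigma> \<in> {1, -1}" and dyn: "spin_pole_dynamics \<sigma> m0 s x x'"
    and inj: "inj (x t)" and nz: "\<And>j. s t j \<noteq> 0"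
    and ev: "\<And>j. eventually (\<lambda>u. spinor_factors (s u j) (\<psi> u j) (\<phi> u j)) (nhds t)"
    and \<psi>: "\<And>j. (\<lambda>u. \<psi> u j) differentiable (at t)" and \<phi>: "\<And>j. (\<lambda>u. \<phi> u j) differentiable (at t)"
    and L: "\<And>u. L u = spin_lax (\<i> * \<sigma>) (\<psi> u) (\<phi> u) (x u) (x' u)"
  obtains B where "(L has_vector_derivative (B ** L t - L t ** B)) (at t)"
    "\<And>j k. j \<noteq> k \<Longrightarrow> L t $ j $ k = B $ j $ k * (x t j - x t k)"
proof -
  define \<alpha> where "\<alpha> = \<i> * of_real \<sigma>"
  have \<alpha>2: "\<alpha> * \<alpha> = -1" using \<sigma> by (auto simp: \<alpha>_def)
  have f: "spinor_factors (s t j) (\<psi> t j) (\<phi> t j)" for j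
    using ev by (rule eventually_nhds_x_imp_x)
  \<comment> \<open>2 i \<alpha> = -2 \<sigma>, so this field brings the spin equation into the form
    S' = S D - D S of \<open>spinor_factors_derivative\<close>.\<close>
  define d where "d j = (\<Sum>k\<in>UNIV - {j}. (\<alpha> / (x t j - x t k)\<^sup>2) *s s t k)" for j
  define p where "p j k = spinor_pair (\<phi> t j) (\<psi> t k)" for j k
  have pjj: "p j j = 0" for j unfolding p_def by (rule spinor_pair_self[OF f])
  have xne: "x t j - x t k \<noteq> 0" if "j \<noteq> k" for j k
    using inj that by (auto dest: injD)
  have s': "((\<lambda>u. s u j) has_vector_derivative (2 * \<i>) *s ccross (s t j) (d j)) (at t)" for j
  proof -
    have eq: "of_real \<sigma> *s (- 2 *s (\<Sum>k\<in>UNIV - {j}. (1 / (x t j - x t k)\<^sup>2) *s ccross (s t j) (s t k)))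
      = (2 * \<i>) *s ccross (s t j) (d j)"
      unfolding d_def ccross_sum_right vec_eq_iff
      by (simp add: \<alpha>_def sum_distrib_left) (simp add: mult.left_commute algebra_simps flip: sum_negf)
    have "((\<lambda>u. s u j) has_vector_derivative
        of_real \<sigma> *s (- 2 *s (\<Sum>k\<in>UNIV - {j}. (1 / (x t j - x t k)\<^sup>2) *s ccross (s t j) (s t k)))) (at t)"
      using dyn unfolding spin_pole_dynamics_def by blast
    then show ?thesis unfolding eq .
  qed
  define derivs where "derivs j \<psi>' \<phi>' g \<longleftrightarrow>
      ((\<lambda>u. \<psi> u j) has_vector_derivative \<psi>') (at t) \<and> ((\<lambda>u. \<phi> u j) has_vector_derivative \<phi>') (at t)
      \<and> \<psi>' = g *s \<psi> t j - pauli (d j) *v \<psi> t j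
      \<and> (\<forall>\<eta>. spinor_pair \<phi>' \<eta> = spinor_pair (\<phi> t j) (pauli (d j) *v \<eta>) - g * spinor_pair (\<phi> t j) \<eta>)"
    for j \<psi>' \<phi>' g
  have "\<exists>\<psi>' \<phi>' g. derivs j \<psi>' \<phi>' g" for j
  proof -
    obtain \<psi>' \<phi>' where 1: "((\<lambda>u. \<psi> u j) has_vector_derivative \<psi>') (at t)"
      and 2: "((\<lambda>u. \<phi> u j) has_vector_derivative \<phi>') (at t)"
      using \<psi>[of j] \<phi>[of j] unfolding vector_derivative_works by blast
    show ?thesis
      by (rule spinor_factors_derivative[OF ev 1 2 s' nz]) (use 1 2 derivs_def in blast)
  qed
  then obtain \<psi>' \<phi>' g where derivs: "\<And>j. derivs j (\<psi>' j) (\<phi>' j) (g j)"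
    by metis
  have \<psi>': "((\<lambda>u. \<psi> u j) has_vector_derivative \<psi>' j) (at t)"
    and \<phi>': "((\<lambda>u. \<phi> u j) has_vector_derivative \<phi>' j) (at t)"
    and \<psi>'_eq: "\<psi>' j = g j *s \<psi> t j - pauli (d j) *v \<psi> t j"
    and \<phi>'_eq: "spinor_pair (\<phi>' j) \<eta> = spinor_pair (\<phi> t j) (pauli (d j) *v \<eta>) - g j * spinor_pair (\<phi> t j) \<eta>"
    for j \<eta>
    using derivs[of j] unfolding derivs_def by blast+
  have mid: "spinor_pair (\<phi> t j) (pauli (d i) *v \<psi> t k)
      = (\<Sum>l\<in>UNIV - {i}. \<alpha> / (x t i - x t l)\<^sup>2 * (p j l * p l k))" for i j k
    unfolding d_def pauli_sum_mult_vec spinor_pair_sum p_def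
    by (simp add: spinor_pair_pauli[OF f])
  \<comment> \<open>The diagonal absorbs the rescaling rates of the spinors, which are arbitrary
    here; the relation between \<open>L\<close> and \<open>B\<close> constrains only off-diagonal
    entries.\<close>
  define B :: "complex^'n^'n" where
    "B = (\<chi> j k. if j = k then - g j else \<alpha> * p j k / (x t j - x t k)\<^sup>2)"
  have Lt: "L t $ j $ k = (if j = k then x' t j else \<alpha> * p j k / (x t j - x t k))" for j k
    by (simp add: L spin_lax_def p_def \<alpha>_def)
  have x': "((\<lambda>u. x u j) has_vector_derivative x' t j) (at t)"
    and x'': "((\<lambda>u. x' u j) has_vector_derivative
        4 * (\<Sum>k\<in>UNIV - {j}. cdot (s t j) (s t k) / (x t j - x t k) ^ 3)) (at t)" for j
    using dyn unfolding spin_pole_dynamics_def by blast+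
  have BL: "(B ** L t - L t ** B) $ j $ k = (\<Sum>l\<in>UNIV. B $ j $ l * L t $ l $ k - L t $ j $ l * B $ l $ k)" for j k
    by (simp add: matrix_matrix_mult_def sum_subtractf)
  have diag: "((\<lambda>u. L u $ j $ j) has_vector_derivative (B ** L t - L t ** B) $ j $ j) (at t)" for j
  proof -
    have "4 * (\<Sum>k\<in>UNIV - {j}. cdot (s t j) (s t k) / (x t j - x t k) ^ 3)
       = (\<Sum>l\<in>UNIV - {j}. B $ j $ l * L t $ l $ j - L t $ j $ l * B $ l $ j)"
      unfolding sum_distrib_left
    proof (rule sum.cong[OF refl])
      fix l assume l: "l \<in> UNIV - {j}"
      define q where "q = x t j - x t l"
      have q: "q \<noteq> 0" "x t l - x t j = - q" using l xne[of j l] by (auto simp: q_def)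
      have "B $ j $ l * L t $ l $ j - L t $ j $ l * B $ l $ j
          = - 2 * (\<alpha> * \<alpha>) * (p j l * p l j) / q ^ 3"
        using l by (simp add: B_def Lt q_def[symmetric] q(2) power2_eq_square power3_eq_cube) (simp add: q(1) divide_simps)
      also have "\<dots> = 4 * (cdot (s t j) (s t l) / q ^ 3)"
        using cdot_spinor_factors[OF f f, of j l] unfolding \<alpha>2 p_def by simp
      finally show "4 * (cdot (s t j) (s t l) / (x t j - x t l) ^ 3)
          = B $ j $ l * L t $ l $ j - L t $ j $ l * B $ l $ j" by (simp add: q_def)
    qed
    also have "\<dots> = (B ** L t - L t ** B) $ j $ j"
      unfolding BL by (subst (2) sum.remove[of _ j]) auto
    finally show ?thesis using x''[of j] by (simp add: L spin_lax_def)
  qed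
  have off: "((\<lambda>u. L u $ j $ k) has_vector_derivative (B ** L t - L t ** B) $ j $ k) (at t)" if jk: "j \<noteq> k" for j k
  proof -
    define q where "q = x t j - x t k"
    have q: "q \<noteq> 0" using xne[OF jk] by (simp add: q_def)
    define p' where "p' = spinor_pair (\<phi>' j) (\<psi> t k) + spinor_pair (\<phi> t j) (\<psi>' k)"
    have pair: "((\<lambda>u. \<phi> u j $ i * \<psi> u k $ i) has_vector_derivative
        \<phi> t j $ i * \<psi>' k $ i + \<phi>' j $ i * \<psi> t k $ i) (at t)" for i
      by (intro has_vector_derivative_mult has_vector_derivative_vec_nth \<phi>' \<psi>')
    have p': "((\<lambda>u. spinor_pair (\<phi> u j) (\<psi> u k)) has_vector_derivative p') (at t)"
      unfolding spinor_pair_def p'_def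
      by (rule has_vector_derivative_eq_rhs[OF has_vector_derivative_add[OF pair pair]]) simp
    have 1: "((\<lambda>u. \<alpha> * spinor_pair (\<phi> u j) (\<psi> u k) / (x u j - x u k)) has_vector_derivative
        \<alpha> * p' / q - \<alpha> * p j k * (x' t j - x' t k) / (q * q)) (at t)"
      unfolding p_def q_def
      by (rule has_vector_derivative_divide[OF has_vector_derivative_mult_right[OF p']
          has_vector_derivative_diff[OF x' x'] xne[OF jk]])
    let ?R = "UNIV - {j} - {k}"
    have R: "(\<Sum>l\<in>UNIV - {j}. h l) = h k + (\<Sum>l\<in>?R. h l)" "(\<Sum>l\<in>UNIV - {k}. h l) = h j + (\<Sum>l\<in>?R. h l)"
      "(\<Sum>l\<in>UNIV. h l) = h j + (h k + (\<Sum>l\<in>?R. h l))" for h :: "'n \<Rightarrow> complex"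
    proof -
      show a: "(\<Sum>l\<in>UNIV - {j}. h l) = h k + (\<Sum>l\<in>?R. h l)"
        by (rule sum.remove) (use jk in auto)
      have "UNIV - {k} - {j} = ?R" by auto
      then show "(\<Sum>l\<in>UNIV - {k}. h l) = h j + (\<Sum>l\<in>?R. h l)"
        using sum.remove[of "UNIV - {k}" j h] jk by auto
      show "(\<Sum>l\<in>UNIV. h l) = h j + (h k + (\<Sum>l\<in>?R. h l))"
        using sum.remove[of UNIV j h] a by auto
    qed
    have "p' = (g k - g j) * p j k + (\<Sum>l\<in>UNIV - {j}. \<alpha> / (x t j - x t l)\<^sup>2 * (p j l * p l k))
        - (\<Sum>l\<in>UNIV - {k}. \<alpha> / (x t k - x t l)\<^sup>2 * (p j l * p l k))"
    proof -
      have "spinor_pair (\<phi> t j) (\<psi>' k) = g k * p j k - spinor_pair (\<phi> t j) (pauli (d k) *v \<psi> t k)"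
        unfolding \<psi>'_eq p_def by (simp add: spinor_pair_def algebra_simps)
      moreover have "spinor_pair (\<phi>' j) (\<psi> t k) = spinor_pair (\<phi> t j) (pauli (d j) *v \<psi> t k) - g j * p j k"
        by (simp add: \<phi>'_eq p_def)
      ultimately show ?thesis unfolding p'_def mid by (simp add: algebra_simps)
    qed
    also have "\<dots> = (g k - g j) * p j k
        + (\<Sum>l\<in>?R. \<alpha> / (x t j - x t l)\<^sup>2 * (p j l * p l k) - \<alpha> / (x t k - x t l)\<^sup>2 * (p j l * p l k))"
      unfolding R by (simp add: pjj sum_subtractf)
    finally have pe: "p' = (g k - g j) * p j k
        + (\<Sum>l\<in>?R. \<alpha> / (x t j - x t l)\<^sup>2 * (p j l * p l k) - \<alpha> / (x t k - x t l)\<^sup>2 * (p j l * p l k))" .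
    have "\<alpha> * p' / q = \<alpha> / q * p'" by simp
    also have "\<dots> = \<alpha> / q * ((g k - g j) * p j k)
        + (\<Sum>l\<in>?R. \<alpha> / q * (\<alpha> / (x t j - x t l)\<^sup>2 * (p j l * p l k) - \<alpha> / (x t k - x t l)\<^sup>2 * (p j l * p l k)))"
      unfolding pe by (simp only: distrib_left sum_distrib_left)
    also have "(\<Sum>l\<in>?R. \<alpha> / q * (\<alpha> / (x t j - x t l)\<^sup>2 * (p j l * p l k) - \<alpha> / (x t k - x t l)\<^sup>2 * (p j l * p l k)))
        = (\<Sum>l\<in>?R. B $ j $ l * L t $ l $ k - L t $ j $ l * B $ l $ k)"
    proof (rule sum.cong[OF refl])
      fix l assume l: "l \<in> ?R"
      have "\<alpha> / (v + w) * (\<alpha> / v\<^sup>2 * (P * Q) - \<alpha> / w\<^sup>2 * (P * Q))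
          = \<alpha> * P / v\<^sup>2 * (\<alpha> * Q / w) - \<alpha> * P / v * (\<alpha> * Q / w\<^sup>2)"
        if "v \<noteq> 0" "w \<noteq> 0" "v + w \<noteq> 0" for v w P Q :: complex
      proof -
        have "1 / v\<^sup>2 - 1 / w\<^sup>2 = (v + w) * (1 / (v\<^sup>2 * w) - 1 / (v * w\<^sup>2))"
          using that(1,2) by (simp add: field_simps power2_eq_square)
        then have "(1 / v\<^sup>2 - 1 / w\<^sup>2) / (v + w) = 1 / (v\<^sup>2 * w) - 1 / (v * w\<^sup>2)"
          using that(3) by simp
        then have "\<alpha> * \<alpha> * P * Q * ((1 / v\<^sup>2 - 1 / w\<^sup>2) / (v + w))
            = \<alpha> * \<alpha> * P * Q * (1 / (v\<^sup>2 * w) - 1 / (v * w\<^sup>2))" by (rule arg_cong)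
        then show ?thesis by (simp add: divide_inverse algebra_simps)
      qed
      from this[of "x t j - x t l" "x t l - x t k" "p j l" "p l k"]
      show "\<alpha> / q * (\<alpha> / (x t j - x t l)\<^sup>2 * (p j l * p l k) - \<alpha> / (x t k - x t l)\<^sup>2 * (p j l * p l k))
        = B $ j $ l * L t $ l $ k - L t $ j $ l * B $ l $ k"
        using l xne[of j l] xne[of l k] q by (auto simp: B_def Lt q_def power2_commute[of "x t k"])
    qed
    finally have 2: "\<alpha> * p' / q = \<alpha> / q * ((g k - g j) * p j k)
        + (\<Sum>l\<in>?R. B $ j $ l * L t $ l $ k - L t $ j $ l * B $ l $ k)" .
    have "(B ** L t - L t ** B) $ j $ k = \<alpha> * p' / q - \<alpha> * p j k * (x' t j - x' t k) / (q * q)"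
      unfolding BL R 2 using jk q
      by (simp add: B_def Lt q_def[symmetric] power2_eq_square divide_inverse algebra_simps)
    then show ?thesis using 1 jk by (simp add: L spin_lax_def \<alpha>_def)
  qed
  show ?thesis
  proof (rule that)
    show "(L has_vector_derivative (B ** L t - L t ** B)) (at t)"
      using diag off by (intro has_vector_derivative_vec) metis
    show "L t $ j $ k = B $ j $ k * (x t j - x t k)" if "j \<noteq> k" for j k
      using xne[OF that] that by (simp add: Lt B_def power2_eq_square)
  qed
qed

lemma pole_polynomial_spin_lax:
  fixes s :: "real \<Rightarrow> 'n::finite \<Rightarrow> complex^3" and x x' :: "real \<Rightarrow> 'n \<Rightarrow> complex"
  assumes \<sigma>: "\<sigma> \<in> {1, -1}" and dyn: "spin_pole_dynamics \<sigma> m0 s x x'"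
    and inj: "\<And>t. inj (x t)" and nz: "\<And>t j. s t j \<noteq> 0" and null: "\<And>t j. cdot (s t j) (s t j) = 0"
    and f: "\<And>j. spinor_factors (s 0 j) (\<psi> j) (\<phi> j)"
  shows "(\<Prod>j\<in>UNIV. z - x t j) = det (mat z - t *\<^sub>R spin_lax (\<i> * \<sigma>) \<psi> \<phi> (x 0) (x' 0)
     - (\<chi> j k. if j = k then x 0 j else 0))"
proof -
  \<comment> \<open>These spinors need no regularity in time: they serve to define one determinant
    for all times, which gauge invariance identifies near each time with the determinant of a smooth
    choice.\<close>
  have "\<exists>\<psi> \<phi>. spinor_factors (s u j) \<psi> \<phi>" for u j
    using spinor_factors_exist[OF null nz] .
  then obtain \<psi>0 \<phi>0 where f0: "\<And>u j. spinor_factors (s u j) (\<psi>0 u j) (\<phi>0 u j)"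
    by metis
  define pencil where "pencil \<psi> \<phi> u = mat z - (t - u) *\<^sub>R spin_lax (\<i> * \<sigma>) (\<psi> u) (\<phi> u) (x u) (x' u)
     - (\<chi> j k. if j = k then x u j else 0)" for \<psi> \<phi> :: "real \<Rightarrow> 'n \<Rightarrow> complex^2" and u
  have s': "(\<lambda>u. s u j) differentiable (at u)" for u j
    using dyn unfolding spin_pole_dynamics_def by (blast intro: differentiableI_vector)
  define local_pencil where "local_pencil u M B \<longleftrightarrow> (M has_vector_derivative (B ** M u - M u ** B)) (at u)
      \<and> eventually (\<lambda>v. det (pencil \<psi>0 \<phi>0 v) = det (M v)) (nhds u)"
    for u M and B :: "complex^'n^'n"
  have "\<exists>M B. local_pencil u M B" for u
  proof -
    have "\<exists>\<psi> \<phi>. eventually (\<lambda>v. spinor_factors (s v j) (\<psi> v) (\<phi> v)) (nhds u)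
       \<and> \<psi> differentiable (at u) \<and> \<phi> differentiable (at u)" for j
      by (rule spinor_factors_smooth[of "\<lambda>u. s u j", OF s'[unfolded vector_derivative_works] null nz]) blast
    then have "\<exists>\<psi>. \<forall>j. \<exists>\<phi>. eventually (\<lambda>v. spinor_factors (s v j) (\<psi> j v) (\<phi> v)) (nhds u)
       \<and> \<psi> j differentiable (at u) \<and> \<phi> differentiable (at u)"
      by (intro choice allI)
    then obtain \<psi>1 where "\<forall>j. \<exists>\<phi>. eventually (\<lambda>v. spinor_factors (s v j) (\<psi>1 j v) (\<phi> v)) (nhds u)
       \<and> \<psi>1 j differentiable (at u) \<and> \<phi> differentiable (at u)" ..
    from choice[OF this] obtain \<phi>1
      where ev: "\<And>j. eventually (\<lambda>v. spinor_factors (s v j) (\<psi>1 j v) (\<phi>1 j v)) (nhds u)"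
       and d: "\<And>j. \<psi>1 j differentiable (at u)" "\<And>j. \<phi>1 j differentiable (at u)"
      by blast
    define L1 where "L1 v = spin_lax (\<i> * \<sigma>) (\<lambda>j. \<psi>1 j v) (\<lambda>j. \<phi>1 j v) (x v) (x' v)" for v
    obtain B where B: "(L1 has_vector_derivative (B ** L1 u - L1 u ** B)) (at u)"
      "\<And>j k. j \<noteq> k \<Longrightarrow> L1 u $ j $ k = B $ j $ k * (x u j - x u k)"
      by (rule spin_lax_derivative[where \<psi>="\<lambda>v j. \<psi>1 j v" and \<phi>="\<lambda>v j. \<phi>1 j v" and L=L1, OF \<sigma> dyn inj nz ev])
        (auto simp: L1_def d)
    have x: "((\<lambda>u. x u j) has_vector_derivative L1 u $ j $ j) (at u)" for j
      using dyn unfolding spin_pole_dynamics_def by (simp add: L1_def spin_lax_def)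
    have deriv: "(pencil (\<lambda>v j. \<psi>1 j v) (\<lambda>v j. \<phi>1 j v) has_vector_derivative
        (B ** pencil (\<lambda>v j. \<psi>1 j v) (\<lambda>v j. \<phi>1 j v) u - pencil (\<lambda>v j. \<psi>1 j v) (\<lambda>v j. \<phi>1 j v) u ** B)) (at u)"
      by (rule lax_pencil_commutator[where L=L1 and z=z and \<tau>=t and x=x]) (simp_all add: pencil_def L1_def[symmetric] x B)
    have "eventually (\<lambda>v. \<forall>j. spinor_factors (s v j) (\<psi>1 j v) (\<phi>1 j v)) (nhds u)"
      using ev by (simp add: eventually_all_finite)
    then have ev_eq: "eventually (\<lambda>v. det (pencil \<psi>0 \<phi>0 v) = det (pencil (\<lambda>v j. \<psi>1 j v) (\<lambda>v j. \<phi>1 j v) v)) (nhds u)"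
      unfolding pencil_def
      by eventually_elim (rule spin_lax_det_gauge[of "s _", OF f0 _ nz], blast)
    show ?thesis unfolding local_pencil_def
      by (rule exI[of _ "pencil (\<lambda>v j. \<psi>1 j v) (\<lambda>v j. \<phi>1 j v)"], rule exI[of _ B])
        (use deriv ev_eq in blast)
  qed
  then obtain M B where "\<And>u. local_pencil u (M u) (B u)" by metis
  then have "\<And>u. (M u has_vector_derivative (B u ** M u u - M u u ** B u)) (at u)"
      "\<And>u. eventually (\<lambda>v. det (pencil \<psi>0 \<phi>0 v) = det (M u v)) (nhds u)"
    unfolding local_pencil_def by blast+
  \<comment> \<open>At parameter \<open>t\<close> the coefficient of the Lax matrix vanishes and the
    pencil is diagonal with the poles as roots; at parameter 0 only initial data remain.\<close>
  then have "det (pencil \<psi>0 \<phi>0 t) = det (pencil \<psi>0 \<phi>0 0)"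
    by (rule isospectral_det_constant)
  moreover have "det (pencil \<psi>0 \<phi>0 t) = (\<Prod>j\<in>UNIV. z - x t j)"
    using det_diagonal[of "pencil \<psi>0 \<phi>0 t"] by (simp add: pencil_def mat_def)
  moreover have "det (pencil \<psi>0 \<phi>0 0) = det (mat z - t *\<^sub>R spin_lax (\<i> * \<sigma>) \<psi> \<phi> (x 0) (x' 0)
     - (\<chi> j k. if j = k then x 0 j else 0))"
    unfolding pencil_def using spin_lax_det_gauge[OF f0 f nz] by simp
  ultimately show ?thesis by simp
qed

section \<open>Conserved quantities and the spin bound\<close>

lemma total_spin_constant:
  fixes s :: "real \<Rightarrow> 'n::finite \<Rightarrow> complex^3"
  assumes "spin_pole_dynamics \<sigma> m0 s x x'"
  shows "(\<Sum>j\<in>UNIV. s t j) = (\<Sum>j\<in>UNIV. s 0 j)"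
proof -
  have "((\<lambda>\<tau>. \<Sum>j\<in>UNIV. s \<tau> j) has_vector_derivative 0) (at t)" for t
  proof -
    define f where "f j k = (1 / (x t j - x t k)\<^sup>2) *s ccross (s t j) (s t k)" for j k
    have "f j k = - f k j" for j k
    proof -
      have "ccross (s t j) (s t k) = - ccross (s t k) (s t j)"
        by (simp add: ccross_def vec_eq_iff forall_3)
      then show ?thesis
        by (simp add: f_def power2_commute[of "x t j" "x t k"] vec_eq_iff)
    qed
    then have 0: "(\<Sum>j\<in>UNIV. \<Sum>k\<in>UNIV - {j}. f j k) = 0"
      by (rule sum_antisymmetric)
    have "((\<lambda>\<tau>. \<Sum>j\<in>UNIV. s \<tau> j) has_vector_derivative
        (\<Sum>j\<in>UNIV. of_real \<sigma> *s (- 2 *s (\<Sum>k\<in>UNIV - {j}. f j k)))) (at t)"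
      using assms unfolding spin_pole_dynamics_def f_def by (intro has_vector_derivative_sum) blast
    moreover have "(\<Sum>j\<in>UNIV. of_real \<sigma> *s (- 2 *s (\<Sum>k\<in>UNIV - {j}. f j k)))
        = of_real \<sigma> *s (- 2 *s (\<Sum>j\<in>UNIV. \<Sum>k\<in>UNIV - {j}. f j k))"
      by (simp add: vec_eq_iff sum_distrib_left sum_negf)
    ultimately show ?thesis by (simp add: 0)
  qed
  then show ?thesis by (rule constant_if_derivative_zero)
qed

lemma total_pole_affine:
  fixes x :: "real \<Rightarrow> 'n::finite \<Rightarrow> complex"
  assumes "spin_pole_dynamics \<sigma> m0 s x x'"
  shows "(\<Sum>j\<in>UNIV. x t j) = (\<Sum>j\<in>UNIV. x 0 j) + of_real t * (\<Sum>j\<in>UNIV. x' 0 j)"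
proof -
  have "((\<lambda>\<tau>. \<Sum>j\<in>UNIV. x' \<tau> j) has_vector_derivative 0) (at t)" for t
  proof -
    define f where "f j k = cdot (s t j) (s t k) / (x t j - x t k) ^ 3" for j k
    have "f j k = - f k j" for j k
    proof -
      have "(x t j - x t k) ^ 3 = - ((x t k - x t j) ^ 3)"
        by (simp add: power3_eq_cube algebra_simps)
      then show ?thesis by (simp add: f_def cdot_def mult.commute)
    qed
    then have 0: "(\<Sum>j\<in>UNIV. \<Sum>k\<in>UNIV - {j}. f j k) = 0"
      by (rule sum_antisymmetric)
    have "((\<lambda>\<tau>. \<Sum>j\<in>UNIV. x' \<tau> j) has_vector_derivative
        (\<Sum>j\<in>UNIV. 4 * (\<Sum>k\<in>UNIV - {j}. f j k))) (at t)"
      using assms unfolding spin_pole_dynamics_def f_def by (intro has_vector_derivative_sum) blast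
    then show ?thesis by (simp add: 0 flip: sum_distrib_left)
  qed
  then have x'_const: "(\<Sum>j\<in>UNIV. x' t j) = (\<Sum>j\<in>UNIV. x' 0 j)" for t
    by (rule constant_if_derivative_zero)
  define c where "c = (\<Sum>j\<in>UNIV. x' 0 j)"
  have "((\<lambda>\<tau>. (\<Sum>j\<in>UNIV. x \<tau> j) - of_real \<tau> * c) has_vector_derivative 0) (at t)" for t
  proof -
    have "((\<lambda>\<tau>. \<Sum>j\<in>UNIV. x \<tau> j) has_vector_derivative (\<Sum>j\<in>UNIV. x' t j)) (at t)"
      using assms unfolding spin_pole_dynamics_def by (intro has_vector_derivative_sum) blast
    moreover have "((\<lambda>\<tau>. of_real \<tau> * c) has_vector_derivative c) (at t)"
      unfolding scaleR_conv_of_real[symmetric]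
      by (rule has_vector_derivative_eq_rhs[OF has_vector_derivative_scaleR[OF DERIV_ident has_vector_derivative_const]]) simp
    ultimately have "((\<lambda>\<tau>. (\<Sum>j\<in>UNIV. x \<tau> j) - of_real \<tau> * c) has_vector_derivative
        (\<Sum>j\<in>UNIV. x' t j) - c) (at t)"
      by (rule has_vector_derivative_diff)
    then show ?thesis unfolding x'_const[of t] c_def by simp
  qed
  then have "(\<Sum>j\<in>UNIV. x t j) - of_real t * c = (\<Sum>j\<in>UNIV. x 0 j) - of_real 0 * c"
    by (rule constant_if_derivative_zero)
  then show ?thesis by (simp add: c_def algebra_simps)
qed

text \<open>The sum is affine in time and positive on the whole real line, hence constant. A nonzero
  slope b would make it vanish at the time -a/b, which may lie in the past.\<close>

lemma total_pole_height_constant: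
  fixes x :: "real \<Rightarrow> 'n::finite \<Rightarrow> complex"
  assumes "spin_pole_dynamics \<sigma> m0 s x x'" and pos: "\<And>t j. Im (x t j) > 0"
  shows "(\<Sum>j\<in>UNIV. Im (x t j)) = (\<Sum>j\<in>UNIV. Im (x 0 j))"
proof -
  define a b where "a = (\<Sum>j\<in>UNIV. Im (x 0 j))" and "b = (\<Sum>j\<in>UNIV. Im (x' 0 j))"
  have eq: "(\<Sum>j\<in>UNIV. Im (x t j)) = a + t * b" for t
    using arg_cong[OF total_pole_affine[OF assms(1), of t], of Im] by (simp add: a_def b_def)
  have "b = 0"
  proof (rule ccontr)
    assume "b \<noteq> 0"
    then have "a + (- a / b) * b = 0" by simp
    moreover have "a + (- a / b) * b > 0"
      unfolding eq[symmetric] by (intro sum_pos pos) auto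
    ultimately show False by simp
  qed
  then show ?thesis using eq[of t] by (simp add: a_def)
qed

text \<open>Summing the constraints over all poles, the interaction terms cancel in pairs, and what
  remains expresses the \<open>L\<^sup>2\<close> norm of the map through the conserved total spin.\<close>

lemma mass_identity:
  fixes s :: "'n::finite \<Rightarrow> complex^3"
  assumes "\<And>j. cdot (s j) (pole_field m0 s x j) = 0"
  shows "(\<Sum>i\<in>UNIV. cauchy_form x (\<lambda>k. s k $ i) (\<lambda>k. s k $ i)) = cdot (\<Sum>j\<in>UNIV. s j) (cvec m0)"
proof -
  have 0: "(\<Sum>j\<in>UNIV. \<Sum>k\<in>UNIV - {j}. cdot (s j) (s k) / (x j - x k)) = 0"
  proof (rule sum_antisymmetric)
    fix j k
    show "cdot (s j) (s k) / (x j - x k) = - (cdot (s k) (s j) / (x k - x j))"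
      unfolding minus_divide_right by (simp add: cdot_def mult.commute)
  qed
  have field: "cdot (s j) (pole_field m0 s x j) = \<i> * cdot (s j) (cvec m0)
      - (\<Sum>k\<in>UNIV - {j}. cdot (s j) (s k) / (x j - x k))
      + (\<Sum>k\<in>UNIV. cdot (s j) (cconj (s k)) / (x j - cnj (x k)))" for j
    unfolding pole_field_def cdot_def
    by (simp add: sum_3 sum.distrib sum_distrib_left algebra_simps add_divide_distrib)
  have "0 = (\<Sum>j\<in>UNIV. cdot (s j) (pole_field m0 s x j))" by (simp add: assms)
  also have "\<dots> = \<i> * (\<Sum>j\<in>UNIV. cdot (s j) (cvec m0))
      + (\<Sum>j\<in>UNIV. \<Sum>k\<in>UNIV. cdot (s j) (cconj (s k)) / (x j - cnj (x k)))"
    unfolding field by (simp add: sum.distrib sum_subtractf 0 sum_distrib_left)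
  finally have 1: "\<i> * (\<Sum>j\<in>UNIV. \<Sum>k\<in>UNIV. cdot (s j) (cconj (s k)) / (x j - cnj (x k)))
      = (\<Sum>j\<in>UNIV. cdot (s j) (cvec m0))"
    by (simp add: complex_eq_iff)
  define T where "T i j k = \<i> * cnj (s j $ i) * s k $ i / (x k - cnj (x j))" for i j k
  have "(\<Sum>i\<in>UNIV. cauchy_form x (\<lambda>k. s k $ i) (\<lambda>k. s k $ i))
     = (\<Sum>i\<in>UNIV. \<Sum>j\<in>UNIV. \<Sum>k\<in>UNIV. T i j k)"
    by (simp add: cauchy_form_def T_def)
  also have "\<dots> = (\<Sum>j\<in>UNIV. \<Sum>i\<in>UNIV. \<Sum>k\<in>UNIV. T i j k)"
    by (rule sum.swap)
  also have "\<dots> = (\<Sum>j\<in>UNIV. \<Sum>k\<in>UNIV. \<Sum>i\<in>UNIV. T i j k)"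
    by (rule sum.cong[OF refl], rule sum.swap)
  also have "\<dots> = (\<Sum>k\<in>UNIV. \<Sum>j\<in>UNIV. \<Sum>i\<in>UNIV. T i j k)"
    by (rule sum.swap)
  also have "\<dots> = (\<Sum>k\<in>UNIV. \<Sum>j\<in>UNIV. \<i> * (cdot (s k) (cconj (s j)) / (x k - cnj (x j))))"
    by (intro sum.cong refl) (simp add: T_def cdot_def cconj_def sum_distrib_left sum_divide_distrib mult_ac)
  also have "\<dots> = \<i> * (\<Sum>k\<in>UNIV. \<Sum>j\<in>UNIV. cdot (s k) (cconj (s j)) / (x k - cnj (x j)))"
    by (simp only: sum_distrib_left)
  also have "\<dots> = (\<Sum>j\<in>UNIV. cdot (s j) (cvec m0))" by (rule 1)
  also have "\<dots> = cdot (\<Sum>j\<in>UNIV. s j) (cvec m0)"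
    by (simp add: cdot_def sum_distrib_right sum_component) (rule sum.swap)
  finally show ?thesis .
qed

text \<open>Since |x_j - cnj x_k| \<le> |x_j - x_k| + 2 Y, each Blaschke factor in
  \<open>cauchy_form_ge\<close> has modulus at least 1 / (1 + 2 Y / \<eta>). The bound is uniform in
  time once the sum of the forms is conserved.\<close>

lemma spin_bound:
  fixes s :: "'n::finite \<Rightarrow> complex^3"
  assumes pos: "\<And>j. Im (x j) > 0" and Y: "\<And>j. Im (x j) \<le> Y"
    and sep: "\<And>k. k \<noteq> j \<Longrightarrow> \<eta> \<le> cmod (x j - x k)" and \<eta>: "\<eta> > 0"
  shows "(norm (s j))\<^sup>2 \<le> 2 * Y * ((1 + 2 * Y / \<eta>)\<^sup>2) ^ (CARD('n) - 1)
     * (\<Sum>i\<in>UNIV. Re (cauchy_form x (\<lambda>k. s k $ i) (\<lambda>k. s k $ i)))"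
proof -
  define r where "r k = (cmod (x j - x k) / cmod (x j - cnj (x k)))\<^sup>2" for k
  define R where "R = (1 + 2 * Y / \<eta>)\<^sup>2"
  define P where "P = (\<Prod>k\<in>UNIV - {j}. r k)"
  define M where "M = (\<Sum>i\<in>UNIV. Re (cauchy_form x (\<lambda>k. s k $ i) (\<lambda>k. s k $ i)))"
  have Y0: "Y > 0" using pos[of j] Y[of j] by simp
  have A0: "1 + 2 * Y / \<eta> > 0" using Y0 \<eta> by (simp add: add_pos_nonneg)
  then have R0: "R > 0" by (simp add: R_def)
  have r: "1 / R \<le> r k" if "k \<noteq> j" for k
  proof -
    have d: "cmod (x j - x k) \<ge> \<eta>" using sep that by simp
    have n: "cmod (x j - cnj (x k)) > 0"
      using upper_half_plane_diff_cnj_nonzero[OF pos pos] by simp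
    have "cmod (x j - cnj (x k)) \<le> cmod (x j - x k) + cmod (x k - cnj (x k))"
      using norm_triangle_ineq[of "x j - x k" "x k - cnj (x k)"] by simp
    also have "cmod (x k - cnj (x k)) = 2 * Im (x k)"
      using pos[of k] by (simp add: complex_diff_cnj norm_mult)
    also have "cmod (x j - x k) + 2 * Im (x k) \<le> cmod (x j - x k) + 2 * Y" using Y by simp
    also have "2 * Y \<le> 2 * Y / \<eta> * cmod (x j - x k)"
      using d \<eta> Y0 by (simp add: field_simps)
    finally have "cmod (x j - cnj (x k)) \<le> (1 + 2 * Y / \<eta>) * cmod (x j - x k)"
      by (simp add: algebra_simps)
    then have "1 / (1 + 2 * Y / \<eta>) \<le> cmod (x j - x k) / cmod (x j - cnj (x k))"
      using n A0 by (simp add: divide_le_eq le_divide_eq mult.commute)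
    then have "(1 / (1 + 2 * Y / \<eta>))\<^sup>2 \<le> r k"
      unfolding r_def using A0 by (intro power_mono) auto
    then show ?thesis by (simp add: R_def power_divide)
  qed
  have "(\<Prod>k\<in>UNIV - {j}. 1 / R) \<le> P"
    unfolding P_def by (rule prod_mono) (use r R0 in auto)
  then have P: "(1 / R) ^ (CARD('n) - 1) \<le> P" by simp
  have "(cmod (s j $ i))\<^sup>2 * P / (2 * Im (x j)) \<le> Re (cauchy_form x (\<lambda>k. s k $ i) (\<lambda>k. s k $ i))" for i
    using cauchy_form_ge[of x "\<lambda>k. s k $ i" j] pos by (simp add: P_def r_def)
  then have "(\<Sum>i\<in>UNIV. (cmod (s j $ i))\<^sup>2 * P / (2 * Im (x j))) \<le> M"
    unfolding M_def by (rule sum_mono)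
  then have "(norm (s j))\<^sup>2 * P / (2 * Im (x j)) \<le> M"
    by (simp add: norm_vec_def L2_set_def sum_nonneg sum_distrib_right sum_divide_distrib)
  then have "(norm (s j))\<^sup>2 * P \<le> 2 * Im (x j) * M"
    using pos[of j] by (simp add: divide_le_eq mult.commute)
  moreover have "M \<ge> 0"
    unfolding M_def by (intro sum_nonneg order_trans[OF _ cauchy_form_ge[of x _ j]] divide_nonneg_pos)
      (use pos in \<open>auto intro!: mult_nonneg_nonneg prod_nonneg\<close>)
  ultimately have "(norm (s j))\<^sup>2 * P \<le> 2 * Y * M"
    using Y[of j] by (meson mult_left_mono mult_right_mono order_trans zero_le_numeral)
  moreover have "(norm (s j))\<^sup>2 * (1 / R) ^ (CARD('n) - 1) \<le> (norm (s j))\<^sup>2 * P"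
    using P by (intro mult_left_mono) auto
  ultimately have "(norm (s j))\<^sup>2 / R ^ (CARD('n) - 1) \<le> 2 * Y * M"
    by (simp add: power_divide)
  then show ?thesis
    using R0 by (simp add: R_def M_def divide_le_eq mult_ac)
qed

section \<open>Eigenvalues of dissipative pencils\<close>

lemma diagonal_mult_vec:
  fixes x :: "'n::finite \<Rightarrow> complex"
  shows "((\<chi> j k. if j = k then x j else 0) *v u) $ j = x j * u $ j"
proof -
  have "((\<chi> j k. if j = k then x j else 0) *v u) $ j = (\<Sum>k\<in>UNIV. if k = j then x j * u $ j else 0)"
    unfolding matrix_vector_mult_def vec_lambda_beta by (rule sum.cong) auto
  then show ?thesis by simp
qed

lemma pencil_eigenvector:
  fixes L :: "complex^'n^'n::finite"
  assumes "det (mat z - t *\<^sub>R L - X) = 0"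
  obtains e where "e \<noteq> 0" "of_real t *s (L *v e) + X *v e = z *s e"
proof -
  let ?M = "mat z - t *\<^sub>R L - X"
  have "\<not> invertible ?M" using assms by (simp add: invertible_det_nz)
  then obtain e where e: "e \<noteq> 0" "?M *v e = 0"
    using matrix_left_invertible_ker[of ?M] invertible_left_inverse[of ?M] by blast
  have "mat z *v e = z *s e"
  proof (intro vec_eq_iff[THEN iffD2] allI)
    fix j
    have "(mat z *v e) $ j = (\<Sum>k\<in>UNIV. if k = j then z * e $ j else 0)"
      unfolding matrix_vector_mult_def mat_def vec_lambda_beta by (rule sum.cong) auto
    then show "(mat z *v e) $ j = (z *s e) $ j" by simp
  qed
  moreover have "(t *\<^sub>R L) *v e = of_real t *s (L *v e)"
    unfolding matrix_vector_mult_def vec_eq_iff vector_scaleR_component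
    by (simp add: sum_distrib_left) (simp add: scaleR_conv_of_real)
  ultimately have "z *s e - of_real t *s (L *v e) - X *v e = 0"
    using e(2) by (simp add: matrix_vector_mult_diff_rdistrib)
  then show ?thesis using that[OF e(1)] by (simp add: algebra_simps)
qed

text \<open>Along unit eigenvectors of \<open>t L + X\<close> with \<open>t \<rightarrow> \<infinity>\<close> and imaginary parts tending to \<open>0\<close>,
  a limit vector \<open>e\<close> is an eigenvector of \<open>L\<close>; testing the eigenvalue equation against the
  eigenspace of \<open>L\<close> shows that \<open>X e\<close> is a real multiple of \<open>e\<close>.\<close>

lemma pencil_eigenvalue_gap:
  fixes L :: "complex^'n^'n::finite" and x :: "'n \<Rightarrow> complex"
    and h :: "complex^'n \<Rightarrow> complex^'n \<Rightarrow> complex"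
  defines "X \<equiv> (\<chi> j k. if j = k then x j else 0) :: complex^'n^'n"
  assumes h_add: "\<And>u v w. h u (v + w) = h u v + h u w"
    and h_scale: "\<And>u v c. h u (c *s v) = c * h u v"
    and h_herm: "\<And>u v. h u v = cnj (h v u)"
    and h_pos: "\<And>u. u \<noteq> 0 \<Longrightarrow> Re (h u u) > 0"
    and h_cont: "\<And>(f :: nat \<Rightarrow> complex^'n) g a b. f \<longlonglongrightarrow> a \<Longrightarrow> g \<longlonglongrightarrow> b \<Longrightarrow> (\<lambda>n. h (f n) (g n)) \<longlonglongrightarrow> h a b"
    and L_herm: "\<And>u v. h u (L *v v) = h (L *v u) v"
    and X_diss: "\<And>u. Im (h u (X *v u)) \<ge> 0"
    and comm: "\<And>u. Im (h u (X *v u)) = 0 \<Longrightarrow> L *v (X *v u) = X *v (L *v u)"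
    and x: "\<And>j. Im (x j) > 0"
  shows "\<exists>T. \<exists>B>0. \<forall>t \<mu> e. \<bar>t\<bar> \<ge> T \<and> e \<noteq> 0 \<and> of_real t *s (L *v e) + X *v e = \<mu> *s e \<longrightarrow> Im \<mu> \<ge> B"
proof (rule ccontr)
  assume neg: "\<not> ?thesis"
  have "\<exists>t \<mu> e. \<bar>t\<bar> \<ge> real n + 1 \<and> norm e = 1 \<and> of_real t *s (L *v e) + X *v e = \<mu> *s e \<and> Im \<mu> < 1 / (real n + 1)" for n
  proof -
    have "1 / (real n + 1) > 0" by simp
    then obtain t \<mu> e where e: "\<bar>t\<bar> \<ge> real n + 1" "e \<noteq> 0" "of_real t *s (L *v e) + X *v e = \<mu> *s e" "Im \<mu> < 1 / (real n + 1)"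
      using neg by (metis not_le)
    define e' where "e' = (1 / norm e) *\<^sub>R e"
    have e': "e' = of_real (1 / norm e) *s e"
      unfolding e'_def vec_eq_iff vector_scaleR_component by (simp add: scaleR_conv_of_real)
    have "of_real t *s (L *v e') + X *v e' = of_real (1 / norm e) *s (of_real t *s (L *v e) + X *v e)"
      unfolding e' vector_scalar_commute by (simp add: vec_eq_iff distrib_left mult.left_commute)
    also have "\<dots> = \<mu> *s e'"
      unfolding e(3) e' by (simp add: vec_eq_iff)
    finally show ?thesis using e by (intro exI[of _ t] exI[of _ \<mu>] exI[of _ e']) (simp add: e'_def)
  qed
  then obtain t :: "nat \<Rightarrow> real" and \<mu> e where t: "\<And>n. \<bar>t n\<bar> \<ge> real n + 1" and e1: "\<And>n. norm (e n) = 1"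
    and eig: "\<And>n. of_real (t n) *s (L *v e n) + X *v e n = \<mu> n *s e n" and \<mu>: "\<And>n. Im (\<mu> n) < 1 / (real n + 1)"
    by metis
  have "compact (sphere (0 :: complex^'n) 1)" by simp
  then obtain a r where a: "a \<in> sphere 0 1" and r: "strict_mono r" and lim: "(e \<circ> r) \<longlonglongrightarrow> a"
    using e1 unfolding compact_def by (metis mem_sphere_0)
  have a0: "a \<noteq> 0" using a by auto
  define f where "f n = e (r n)" for n
  define T where "T n = t (r n)" for n
  define l where "l n = \<mu> (r n)" for n
  have f: "f \<longlonglongrightarrow> a" using lim by (simp add: f_def[abs_def] comp_def)
  have f0: "f n \<noteq> 0" for n using e1[of "r n"] by (auto simp: f_def)
  have T_ge: "\<bar>T n\<bar> \<ge> real n + 1" for n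
    using t[of "r n"] seq_suble[OF r, of n] by (simp add: T_def)
  then have T0: "T n \<noteq> 0" for n by (metis abs_zero not_le of_nat_0_le_iff add_pos_nonneg zero_less_one add.commute)
  have l_lt: "Im (l n) < 1 / (real n + 1)" for n
  proof -
    have "Im (l n) < 1 / (real (r n) + 1)" using \<mu> by (simp add: l_def)
    also have "\<dots> \<le> 1 / (real n + 1)" using seq_suble[OF r, of n] by (intro divide_left_mono) auto
    finally show ?thesis .
  qed
  have eig: "of_real (T n) *s (L *v f n) + X *v f n = l n *s f n" for n
    using eig[of "r n"] by (simp add: T_def f_def l_def)
  have invT: "(\<lambda>n. 1 / T n) \<longlonglongrightarrow> 0"
  proof (rule tendsto_rabs_zero_cancel, rule real_tendsto_sandwich)
    show "(\<lambda>n. 0 :: real) \<longlonglongrightarrow> 0" by simp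
    show "(\<lambda>n. 1 / (real n + 1)) \<longlonglongrightarrow> 0"
      using LIMSEQ_inverse_real_of_nat by (simp add: inverse_eq_divide add.commute)
    show "eventually (\<lambda>n. \<bar>1 / T n\<bar> \<le> 1 / (real n + 1)) sequentially"
      using T_ge T0 by (auto simp: field_simps intro!: always_eventually)
  qed simp
  have mv: "(\<lambda>n. M *v g n) \<longlonglongrightarrow> M *v b" if "g \<longlonglongrightarrow> b" for M :: "complex^'n^'n" and g b
    using that unfolding matrix_vector_mult_def
    by (intro vec_tendstoI) (auto intro!: tendsto_intros)
  have h_real: "Im (h u u) = 0" for u using h_herm[of u u] by (simp add: complex_eq_iff)
  have hL_real: "Im (h u (L *v u)) = 0" for u
    using L_herm[of u u] h_herm[of u "L *v u"] by (simp add: complex_eq_iff)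
  have h0: "h u u \<noteq> 0" if "u \<noteq> 0" for u using h_pos[OF that] by auto
  have heig: "of_real (T n) * h u (L *v f n) + h u (X *v f n) = l n * h u (f n)" for u n
    using arg_cong[OF eig[of n], of "h u"] by (simp add: h_add h_scale)

  \<comment> \<open>Divided by \<open>T n\<close>, the eigenvalue equation leaves only
    \<open>L\<close> in the limit, so \<open>l n / T n\<close> tends to the Rayleigh quotient of
    \<open>a\<close>, which is real by symmetry.\<close>
  define v where "v = h a (L *v a) / h a a"
  have v: "Im v = 0" using h_real[of a] hL_real[of a] by (simp add: v_def Im_divide)
  have "(\<lambda>n. l n / T n) \<longlonglongrightarrow> v"
  proof -
    have "l n / T n = (h (f n) (L *v f n) + of_real (1 / T n) * h (f n) (X *v f n)) / h (f n) (f n)" for n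
      using heig[of n "f n"] T0[of n] h0[OF f0[of n]] by (simp add: field_simps)
    moreover have "(\<lambda>n. (h (f n) (L *v f n) + of_real (1 / T n) * h (f n) (X *v f n)) / h (f n) (f n))
        \<longlonglongrightarrow> (h a (L *v a) + of_real 0 * h a (X *v a)) / h a a"
      by (intro tendsto_intros h_cont f mv invT h0 a0)
    ultimately show ?thesis by (simp add: v_def)
  qed
  moreover have "l n / T n * f n $ j = (L *v f n) $ j + of_real (1 / T n) * (X *v f n) $ j" for n j
    using arg_cong[OF eig[of n], of "\<lambda>w. w $ j"] T0[of n] by (simp add: field_simps)
  then have "(\<lambda>n. l n / T n * f n $ j) \<longlonglongrightarrow> (L *v a) $ j + of_real 0 * (X *v a) $ j" for j
    by (simp only:) (intro tendsto_intros mv f invT)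
  ultimately have "v * a $ j = (L *v a) $ j" for j
    using LIMSEQ_unique[OF tendsto_mult[OF _ tendsto_vec_nth[OF f]]] by fastforce
  then have La: "L *v a = v *s a" by (simp add: vec_eq_iff)

  \<comment> \<open>\<open>L\<close> contributes nothing to the imaginary part, so the height of the
    eigenvalue equals the dissipation of \<open>X\<close> on the normalized eigenvector.\<close>
  have Im_X: "Im (h (f n) (X *v f n)) = Im (l n) * Re (h (f n) (f n))" for n
    using arg_cong[OF heig[of n "f n"], of Im] h_real[of "f n"] hL_real[of "f n"] by simp
  have l_ge: "Im (l n) \<ge> 0" for n
    using X_diss[of "f n"] h_pos[OF f0[of n]] unfolding Im_X by (simp add: zero_le_mult_iff)
  have Im_l: "(\<lambda>n. Im (l n)) \<longlonglongrightarrow> 0"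
  proof (rule real_tendsto_sandwich)
    show "eventually (\<lambda>n. 0 \<le> Im (l n)) sequentially" by (simp add: l_ge)
    show "eventually (\<lambda>n. Im (l n) \<le> 1 / (real n + 1)) sequentially"
      using l_lt by (intro always_eventually allI less_imp_le)
    show "(\<lambda>n. 1 / (real n + 1)) \<longlonglongrightarrow> 0"
      using LIMSEQ_inverse_real_of_nat by (simp add: inverse_eq_divide add.commute)
  qed simp
  have "(\<lambda>n. Im (l n) * Re (h (f n) (f n))) \<longlonglongrightarrow> 0 * Re (h a a)"
    by (intro tendsto_intros Im_l h_cont f)
  moreover have "(\<lambda>n. Im (l n) * Re (h (f n) (f n))) \<longlonglongrightarrow> Im (h a (X *v a))"
    unfolding Im_X[symmetric] by (intro tendsto_intros h_cont f mv)
  ultimately have ImX0: "Im (h a (X *v a)) = 0"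
    using LIMSEQ_unique by fastforce
  have LX: "L *v (X *v a) = v *s (X *v a)"
    using comm[OF ImX0] by (simp add: La vector_scalar_commute)

  have Xu: "(X *v u) $ j = x j * u $ j" for u j
    unfolding X_def by (rule diagonal_mult_vec)
  define c where "c = h a (X *v a) / h a a"
  have test: "h w (X *v f n) = (l n - T n * v) * h w (f n)" if "L *v w = v *s w" for w n
  proof -
    have "h w (L *v f n) = h (v *s w) (f n)" by (simp add: L_herm that)
    also have "\<dots> = cnj v * h w (f n)"
      using h_herm[of "v *s w"] h_herm[of w] by (simp add: h_scale)
    also have "cnj v = v" using v by (simp add: complex_eq_iff)
    finally show ?thesis using heig[of n w] by (simp add: algebra_simps)
  qed
  \<comment> \<open>The factor \<open>l n - T n * v\<close> has no evident limit, but it is the same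
    for \<open>w\<close> and for \<open>a\<close>; cross-multiplying eliminates it before the limit
    is taken.\<close>
  have hX: "h w (X *v a) = c * h w a" if w: "L *v w = v *s w" for w
  proof -
    have "h w (X *v f n) * h a (f n) = h a (X *v f n) * h w (f n)" for n
      by (simp add: test[OF w] test[OF La])
    moreover have "(\<lambda>n. h w (X *v f n) * h a (f n)) \<longlonglongrightarrow> h w (X *v a) * h a a"
      by (intro tendsto_intros h_cont f mv tendsto_const)
    moreover have "(\<lambda>n. h a (X *v f n) * h w (f n)) \<longlonglongrightarrow> h a (X *v a) * h w a"
      by (intro tendsto_intros h_cont f mv tendsto_const)
    ultimately have "h w (X *v a) * h a a = h a (X *v a) * h w a"
      by (simp add: LIMSEQ_unique)
    then show ?thesis using h0[OF a0] by (simp add: c_def field_simps)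
  qed
  \<comment> \<open>Commutation puts \<open>X *v a\<close> into the eigenspace of \<open>L\<close>,
    so the part of it orthogonal to \<open>a\<close> is an admissible test vector, and testing with
    it shows that it is orthogonal to itself.\<close>
  define w where "w = X *v a + (- c) *s a"
  have "L *v w = v *s w"
    unfolding w_def matrix_vector_right_distrib vector_scalar_commute LX La
    by (simp add: vec_eq_iff algebra_simps)
  then have "h w (X *v a) = c * h w a" by (rule hX)
  moreover have "h w w = h w (X *v a + (- c) *s a)" by (simp only: w_def)
  then have "h w w = h w (X *v a) + (- c) * h w a" by (simp only: h_add h_scale)
  ultimately have "h w w = 0" by simp
  then have "w = 0" using h0 by blast
  \<comment> \<open>\<open>X\<close> is diagonal, so its eigenvalue \<open>c\<close> is one of the
    \<open>x j\<close>, although \<open>c\<close> is real.\<close>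
  then have Xa: "x j * a $ j = c * a $ j" for j
    by (simp add: w_def vec_eq_iff Xu)
  have "Im c = 0"
    using h_real[of a] ImX0 by (simp add: c_def Im_divide)
  moreover obtain j where "a $ j \<noteq> 0" using a0 by (auto simp: vec_eq_iff)
  with Xa[of j] have "x j = c" by simp
  ultimately show False using x[of j] by simp
qed

section \<open>The Gram form of the spinors\<close>

lemma pauli_mult_spinor:
  assumes "spinor_factors s \<psi> \<phi>"
  shows "pauli s *v u = spinor_pair \<phi> u *s \<psi>"
proof -
  have "s $ 3 * u $ 1 + (s $ 1 - \<i> * s $ 2) * u $ 2 = spinor_pair \<phi> u * \<psi> $ 1"
    unfolding spinor_factors_entries(3)[OF assms] spinor_factors_entries(1)[OF assms]
    by (simp add: spinor_pair_def algebra_simps)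
  moreover have "(s $ 1 + \<i> * s $ 2) * u $ 1 + (- s $ 3) * u $ 2 = spinor_pair \<phi> u * \<psi> $ 2"
    unfolding spinor_factors_entries(4)[OF assms] spinor_factors_entries(2)[OF assms]
    by (simp add: spinor_pair_def algebra_simps)
  ultimately show ?thesis
    by (simp add: vec_eq_iff forall_2 pauli_mult_vec)
qed

text \<open>Since \<open>s \<times> (d \<times> s) = 0\<close>, the vector \<open>d \<times> s\<close> is a multiple of \<open>s\<close>.\<close>

lemma ccross_null_orthogonal:
  assumes "cdot s s = 0" "cdot s d = 0"
  shows "cdot s r *s ccross d s = cdot (ccross s r) d *s s"
proof -
  have 1: "s $ 1 * s $ 1 + s $ 2 * s $ 2 + s $ 3 * s $ 3 = 0"
    and 2: "s $ 1 * d $ 1 + s $ 2 * d $ 2 + s $ 3 * d $ 3 = 0"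
    using assms by (simp_all add: cdot_def sum_3)
  have "cdot s r * ccross d s $ i = cdot (ccross s r) d * s $ i" for i
    using exhaust_3[of i]
  proof (elim disjE)
    assume i: "i = 1"
    show ?thesis unfolding i cdot_def sum_3 ccross_def vector_3 using 1 2 by algebra
  next
    assume i: "i = 2"
    show ?thesis unfolding i cdot_def sum_3 ccross_def vector_3 using 1 2 by algebra
  next
    assume i: "i = 3"
    show ?thesis unfolding i cdot_def sum_3 ccross_def vector_3 using 1 2 by algebra
  qed
  then show ?thesis by (simp add: vec_eq_iff)
qed

lemma cdot_cconj_self: "cdot s (cconj s) = of_real ((norm s)\<^sup>2)"
  by (simp add: cdot_def cconj_def norm_vec_def L2_set_def sum_nonneg complex_norm_square[symmetric])

lemma cdot_scale_left: "cdot (a *s u) v = a * cdot u v"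
  by (simp add: cdot_def sum_distrib_left mult.assoc)

text \<open>The product of \<open>pauli d\<close> and \<open>pauli s\<close> has scalar part s . d =
  0 and vector part i (d \<times> s), and d \<times> s is a multiple of s. The multiple is the
  expression that prescribes the initial pole velocities, up to \<sigma>, when d is the pole field;
  this is how the velocities enter the self-adjointness.\<close>

lemma pauli_eigenspinor:
  assumes f: "spinor_factors s \<psi> \<phi>" and nz: "s \<noteq> 0" and null: "cdot s s = 0" and orth: "cdot s d = 0"
  shows "pauli d *v \<psi> = (\<i> * cdot ((1 / cdot s (cconj s)) *s ccross s (cconj s)) d) *s \<psi>"
proof -
  define \<kappa> where "\<kappa> = cdot ((1 / cdot s (cconj s)) *s ccross s (cconj s)) d"
  have N: "cdot s (cconj s) \<noteq> 0" using nz by (simp add: cdot_cconj_self)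
  have "cdot s (cconj s) * \<kappa> = cdot (ccross s (cconj s)) d"
    using N by (simp add: \<kappa>_def cdot_scale_left)
  then have "cdot s (cconj s) * ccross d s $ i = cdot s (cconj s) * (\<kappa> * s $ i)" for i
    using arg_cong[OF ccross_null_orthogonal[OF null orth, of "cconj s"], of "\<lambda>v. v $ i"]
    by (simp flip: mult.assoc)
  then have cross: "ccross d s $ i = \<kappa> * s $ i" for i using N by simp
  have dot: "s $ 1 * d $ 1 + s $ 2 * d $ 2 + s $ 3 * d $ 3 = 0"
    using orth by (simp add: cdot_def sum_3)
  have c: "d $ 2 * s $ 3 - d $ 3 * s $ 2 = \<kappa> * s $ 1" "d $ 3 * s $ 1 - d $ 1 * s $ 3 = \<kappa> * s $ 2"
    "d $ 1 * s $ 2 - d $ 2 * s $ 1 = \<kappa> * s $ 3"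
    using cross[of 1] cross[of 2] cross[of 3] by (simp_all add: ccross_def)
  note e = spinor_factors_entries[OF f]
  have key: "(pauli d *v \<psi>) $ i * \<phi> $ j = \<i> * \<kappa> * (\<psi> $ i * \<phi> $ j)" for i j
  proof -
    have "(pauli d *v \<psi>) $ 1 * \<phi> $ 1 = d $ 3 * (\<psi> $ 1 * \<phi> $ 1) + (d $ 1 - \<i> * d $ 2) * (\<psi> $ 2 * \<phi> $ 1)"
      by (simp add: pauli_mult_vec algebra_simps)
    also have "\<dots> = \<i> * (d $ 1 * s $ 2 - d $ 2 * s $ 1) + (s $ 1 * d $ 1 + s $ 2 * d $ 2 + s $ 3 * d $ 3)"
      unfolding e[symmetric] by (simp add: algebra_simps)
    also have "\<dots> = \<i> * \<kappa> * (\<psi> $ 1 * \<phi> $ 1)"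
      unfolding dot c e[symmetric] by simp
    finally have 11: "(pauli d *v \<psi>) $ 1 * \<phi> $ 1 = \<i> * \<kappa> * (\<psi> $ 1 * \<phi> $ 1)" .
    have "(pauli d *v \<psi>) $ 2 * \<phi> $ 2 = (d $ 1 + \<i> * d $ 2) * (\<psi> $ 1 * \<phi> $ 2) - d $ 3 * (\<psi> $ 2 * \<phi> $ 2)"
      by (simp add: pauli_mult_vec algebra_simps)
    also have "\<dots> = - \<i> * (d $ 1 * s $ 2 - d $ 2 * s $ 1) + (s $ 1 * d $ 1 + s $ 2 * d $ 2 + s $ 3 * d $ 3)"
      unfolding e[symmetric] by (simp add: algebra_simps)
    also have "\<dots> = \<i> * \<kappa> * (\<psi> $ 2 * \<phi> $ 2)"
      unfolding dot c e[symmetric] by simp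
    finally have 22: "(pauli d *v \<psi>) $ 2 * \<phi> $ 2 = \<i> * \<kappa> * (\<psi> $ 2 * \<phi> $ 2)" .
    have "(pauli d *v \<psi>) $ 1 * \<phi> $ 2 = d $ 3 * (\<psi> $ 1 * \<phi> $ 2) + (d $ 1 - \<i> * d $ 2) * (\<psi> $ 2 * \<phi> $ 2)"
      by (simp add: pauli_mult_vec algebra_simps)
    also have "\<dots> = (d $ 3 * s $ 1 - d $ 1 * s $ 3) + \<i> * (d $ 2 * s $ 3 - d $ 3 * s $ 2)"
      unfolding e[symmetric] by (simp add: algebra_simps)
    also have "\<dots> = \<i> * \<kappa> * (\<psi> $ 1 * \<phi> $ 2)"
      unfolding c e[symmetric] by (simp add: algebra_simps)
    finally have 12: "(pauli d *v \<psi>) $ 1 * \<phi> $ 2 = \<i> * \<kappa> * (\<psi> $ 1 * \<phi> $ 2)" .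
    have "(pauli d *v \<psi>) $ 2 * \<phi> $ 1 = (d $ 1 + \<i> * d $ 2) * (\<psi> $ 1 * \<phi> $ 1) - d $ 3 * (\<psi> $ 2 * \<phi> $ 1)"
      by (simp add: pauli_mult_vec algebra_simps)
    also have "\<dots> = - (d $ 3 * s $ 1 - d $ 1 * s $ 3) + \<i> * (d $ 2 * s $ 3 - d $ 3 * s $ 2)"
      unfolding e[symmetric] by (simp add: algebra_simps)
    also have "\<dots> = \<i> * \<kappa> * (\<psi> $ 2 * \<phi> $ 1)"
      unfolding c e[symmetric] by (simp add: algebra_simps)
    finally have 21: "(pauli d *v \<psi>) $ 2 * \<phi> $ 1 = \<i> * \<kappa> * (\<psi> $ 2 * \<phi> $ 1)" .
    show ?thesis using exhaust_2[of i] exhaust_2[of j] 11 12 21 22 by auto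
  qed
  obtain i j where "\<psi> $ i \<noteq> 0" "\<phi> $ j \<noteq> 0"
    using spinor_factors_nonzero[OF f nz] .
  then have "(pauli d *v \<psi>) $ k = \<i> * \<kappa> * \<psi> $ k" for k
    using key[of k j] by simp
  then show ?thesis by (simp add: vec_eq_iff \<kappa>_def)
qed

text \<open>Up to a factor \<open>2 \<pi>\<close>, the Gram matrix in \<open>L\<^sup>2(\<real>)\<close> of the functions \<open>\<psi>\<^sub>j / (y - x\<^sub>j)\<close>.\<close>

definition spinor_gram :: "('n \<Rightarrow> complex^2) \<Rightarrow> ('n \<Rightarrow> complex) \<Rightarrow> 'n \<Rightarrow> 'n \<Rightarrow> complex" where
  "spinor_gram \<psi> x j k = \<i> * (\<Sum>a\<in>UNIV. cnj (\<psi> j $ a) * \<psi> k $ a) / (x k - cnj (x j))"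

definition gram_form :: "('n::finite \<Rightarrow> complex^2) \<Rightarrow> ('n \<Rightarrow> complex) \<Rightarrow> complex^'n \<Rightarrow> complex^'n \<Rightarrow> complex" where
  "gram_form \<psi> x u v = (\<Sum>j\<in>UNIV. \<Sum>k\<in>UNIV. cnj (u $ j) * spinor_gram \<psi> x j k * v $ k)"

lemma divide_minus_diff: "u / (a - b) = - (u / (b - a))" for u a b :: "'a::field"
  unfolding minus_divide_right by simp

lemma spinor_gram_herm: "cnj (spinor_gram \<psi> x j k) = spinor_gram \<psi> x k j"
  unfolding spinor_gram_def divide_minus_diff[of _ "x j"] by (simp add: mult.commute)

lemma gram_form_herm: "gram_form \<psi> x u v = cnj (gram_form \<psi> x v u)"
  unfolding gram_form_def by (subst sum.swap) (simp add: spinor_gram_herm mult_ac)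

text \<open>The matrix product of the Gram matrix with the Lax matrix is manifestly Hermitian once the
  diagonal entries are replaced by the pole field: partial fractions turn it into a sum over
  all poles.\<close>

lemma spin_lax_gram_herm:
  fixes s :: "'n::finite \<Rightarrow> complex^3"
  assumes \<sigma>: "\<sigma> \<in> {1, -1 :: real}" and pos: "\<And>j. Im (x j) > 0" and inj: "inj x"
    and f: "\<And>j. spinor_factors (s j) (\<psi> j) (\<phi> j)" and nz: "\<And>j. s j \<noteq> 0"
    and null: "\<And>j. cdot (s j) (s j) = 0" and orth: "\<And>j. cdot (s j) (pole_field m0 s x j) = 0"
    and x': "\<And>j. x' j = of_real \<sigma> *
        cdot ((1 / cdot (s j) (cconj (s j))) *s ccross (s j) (cconj (s j))) (pole_field m0 s x j)"
  shows "(\<Sum>k\<in>UNIV. spinor_gram \<psi> x j k * spin_lax (\<i> * of_real \<sigma>) \<psi> \<phi> x x' $ k $ l)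
    = cnj (\<Sum>k\<in>UNIV. spinor_gram \<psi> x l k * spin_lax (\<i> * of_real \<sigma>) \<psi> \<phi> x x' $ k $ j)"
proof -
  define ip where "ip u v = (\<Sum>a\<in>UNIV. cnj (u $ a) * v $ a)" for u v :: "complex^2"
  define b where "b j d l = ip (\<psi> j) (pauli d *v \<psi> l)" for j d l
  \<comment> \<open>Conjugation exchanges the sum over the spins with the sum over their conjugates
    and fixes the term of the real vector \<open>m0\<close>, so this kernel is visibly
    Hermitian.\<close>
  define A where "A j l = (\<i> * b j (cvec m0) l + (\<Sum>k\<in>UNIV. b j (s k) l / (x k - cnj (x j)))
      + (\<Sum>k\<in>UNIV. b j (cconj (s k)) l / (x l - cnj (x k)))) / (x l - cnj (x j))" for j l
  have xne: "x k - x l \<noteq> 0" if "k \<noteq> l" for k l using inj that by (auto dest: injD)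
  have nz': "x k - cnj (x j) \<noteq> 0" for j k
    using upper_half_plane_diff_cnj_nonzero[OF pos pos] .
  have ip_scale: "ip u (c *s v) = c * ip u v" for u v c
    by (simp add: ip_def sum_distrib_left mult.left_commute)
  have b_s: "b j (s k) l = spinor_pair (\<phi> k) (\<psi> l) * ip (\<psi> j) (\<psi> k)" for j k l
    by (simp add: b_def pauli_mult_spinor[OF f] ip_scale)
  have b_add: "b j (u + v) l = b j u l + b j v l" and b_diff: "b j (u - v) l = b j u l - b j v l"
    and b_scale: "b j (c *s u) l = c * b j u l" for j u v l c
    by (simp_all add: b_def ip_def sum_2 pauli_mult_vec algebra_simps)
  have b_sum: "b j (\<Sum>k\<in>S. v k) l = (\<Sum>k\<in>S. b j (v k) l)" for j l S and v :: "'n \<Rightarrow> complex^3"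
  proof (induction S rule: infinite_finite_induct)
    case empty
    show ?case by (simp add: b_def ip_def sum_2 pauli_mult_vec)
  next
    case (infinite S)
    then show ?case by (simp add: b_def ip_def sum_2 pauli_mult_vec)
  qed (simp_all add: b_add)
  have b_cnj: "cnj (b j d l) = b l (cconj d) j" for j d l
    by (simp add: b_def ip_def sum_2 pauli_mult_vec cconj_def algebra_simps)
  have diag: "ip (\<psi> j) (\<psi> l) * x' l * \<i> = of_real \<sigma> * b j (pole_field m0 s x l) l" for j l
    unfolding b_def pauli_eigenspinor[OF f nz null orth] ip_scale x' by (simp add: mult_ac)
  have field: "b j (pole_field m0 s x l) l = \<i> * b j (cvec m0) l
      - (\<Sum>k\<in>UNIV - {l}. b j (s k) l / (x l - x k)) + (\<Sum>k\<in>UNIV. b j (cconj (s k)) l / (x l - cnj (x k)))" for j l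
    unfolding pole_field_def by (simp add: b_add b_diff b_scale b_sum)
  have GL: "(\<Sum>k\<in>UNIV. spinor_gram \<psi> x j k * spin_lax (\<i> * of_real \<sigma>) \<psi> \<phi> x x' $ k $ l) = of_real \<sigma> * A j l" for j l
  proof -
    let ?L = "spin_lax (\<i> * of_real \<sigma>) \<psi> \<phi> x x'"
    define c where "c = 1 / (x l - cnj (x j))"
    have bl: "b j (s l) l = 0" by (simp add: b_s spinor_pair_self[OF f])
    \<comment> \<open>Partial fractions: the terms with x_l - x_k will cancel the singular sum in
      the pole field, which comes from the diagonal entry.\<close>
    have off: "spinor_gram \<psi> x j k * ?L $ k $ l = of_real \<sigma> * c * (b j (s k) l / (x k - cnj (x j)) + b j (s k) l / (x l - x k))"
      if "k \<in> UNIV - {l}" for k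
    proof -
      have "- 1 / (u * w) = 1 / (u + - w) * (1 / u + 1 / (- w))" if "u \<noteq> 0" "w \<noteq> 0" "u + - w \<noteq> 0" for u w :: complex
        using that by (simp add: field_simps)
      from this[of "x k - cnj (x j)" "x k - x l"]
      have 1: "- 1 / ((x k - cnj (x j)) * (x k - x l)) = c * (1 / (x k - cnj (x j)) + 1 / (x l - x k))"
        using that nz'[of k j] nz'[of l j] xne[of k l] by (simp add: c_def)
      have "spinor_gram \<psi> x j k * ?L $ k $ l
          = of_real \<sigma> * b j (s k) l * (- 1 / ((x k - cnj (x j)) * (x k - x l)))"
      proof -
        have "\<i> * P / u * (\<i> * q * p / w) = (\<i> * \<i>) * (q * (p * P) * (1 / (u * w)))" for P u q p w
          by (simp only: divide_inverse inverse_mult_distrib mult_ac mult_1_left mult_1_right)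
        then have "\<i> * P / u * (\<i> * q * p / w) = q * (p * P) * (- 1 / (u * w))" for P u q p w by simp
        then show ?thesis using that by (simp add: spinor_gram_def spin_lax_def b_s ip_def)
      qed
      then show ?thesis unfolding 1 by (simp add: algebra_simps)
    qed
    have "(\<Sum>k\<in>UNIV. spinor_gram \<psi> x j k * ?L $ k $ l) = spinor_gram \<psi> x j l * ?L $ l $ l
        + (\<Sum>k\<in>UNIV - {l}. spinor_gram \<psi> x j k * ?L $ k $ l)"
      by (rule sum.remove) auto
    also have "spinor_gram \<psi> x j l * ?L $ l $ l = c * (ip (\<psi> j) (\<psi> l) * x' l * \<i>)"
      by (simp add: spinor_gram_def spin_lax_def ip_def c_def)
    also have "\<dots> = c * of_real \<sigma> * b j (pole_field m0 s x l) l" unfolding diag by simp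
    also have "(\<Sum>k\<in>UNIV - {l}. spinor_gram \<psi> x j k * ?L $ k $ l)
        = of_real \<sigma> * c * ((\<Sum>k\<in>UNIV - {l}. b j (s k) l / (x k - cnj (x j))) + (\<Sum>k\<in>UNIV - {l}. b j (s k) l / (x l - x k)))"
      unfolding sum.distrib[symmetric] sum_distrib_left by (rule sum.cong[OF refl off])
    \<comment> \<open>The term k = l is zero, so the sum extends to all poles and becomes the mirror
      image of the sum over conjugate spins.\<close>
    also have "(\<Sum>k\<in>UNIV - {l}. b j (s k) l / (x k - cnj (x j))) = (\<Sum>k\<in>UNIV. b j (s k) l / (x k - cnj (x j)))"
      using sum.remove[of UNIV l "\<lambda>k. b j (s k) l / (x k - cnj (x j))"] by (simp add: bl)
    finally show ?thesis
      unfolding field A_def by (simp add: c_def divide_inverse algebra_simps)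
  qed
  have cvec: "cconj (cvec m0) = cvec m0" and conj2: "cconj (cconj u) = u" for u
    by (simp_all add: cconj_def cvec_def vec_eq_iff)
  have "cnj (A l j) = A j l"
  proof -
    have flip: "u / (cnj (x k) - x i) = - (u / (x i - cnj (x k)))" for u i k
      by (rule divide_minus_diff)
    have "cnj (A l j) = (- \<i> * b j (cvec m0) l + (\<Sum>k\<in>UNIV. b j (cconj (s k)) l / (cnj (x k) - x l))
        + (\<Sum>k\<in>UNIV. b j (s k) l / (cnj (x j) - x k))) / (cnj (x j) - x l)"
      by (simp add: A_def b_cnj cvec conj2)
    also have "\<dots> = A j l"
      unfolding flip A_def sum_negf by (simp add: algebra_simps divide_inverse)
    finally show ?thesis .
  qed
  then show ?thesis unfolding GL by simp
qed

section \<open>Positivity, symmetry and dissipation in the Gram form\<close>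

lemma gram_form_cauchy_form:
  "gram_form \<psi> x u v = (\<Sum>a\<in>UNIV. cauchy_form x (\<lambda>k. u $ k * \<psi> k $ a) (\<lambda>k. v $ k * \<psi> k $ a))"
proof -
  define T where "T a j k = \<i> * cnj (u $ j * \<psi> j $ a) * (v $ k * \<psi> k $ a) / (x k - cnj (x j))" for a j k
  have "gram_form \<psi> x u v = (\<Sum>j\<in>UNIV. \<Sum>k\<in>UNIV. \<Sum>a\<in>UNIV. T a j k)"
    unfolding gram_form_def
    by (intro sum.cong refl) (simp add: spinor_gram_def T_def sum_distrib_left sum_distrib_right sum_divide_distrib mult_ac)
  also have "\<dots> = (\<Sum>j\<in>UNIV. \<Sum>a\<in>UNIV. \<Sum>k\<in>UNIV. T a j k)"
    by (rule sum.cong[OF refl], rule sum.swap)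
  also have "\<dots> = (\<Sum>a\<in>UNIV. \<Sum>j\<in>UNIV. \<Sum>k\<in>UNIV. T a j k)"
    by (rule sum.swap)
  finally show ?thesis by (simp add: cauchy_form_def T_def)
qed

lemma cauchy_form_nonneg:
  assumes "\<And>j. Im (x j) > 0"
  shows "Re (cauchy_form x a a) \<ge> 0"
  using cauchy_form_ge[of x a undefined, OF assms] assms[of undefined]
  by (elim order_trans[rotated]) (auto intro!: divide_nonneg_pos mult_nonneg_nonneg prod_nonneg)

lemma gram_form_pos:
  fixes u :: "complex^'n::finite"
  assumes pos: "\<And>j. Im (x j) > 0" and inj: "inj x" and \<psi>: "\<And>j. \<psi> j \<noteq> 0" and u: "u \<noteq> 0"
  shows "Re (gram_form \<psi> x u u) > 0"
proof -
  obtain j where j: "u $ j \<noteq> 0" using u by (auto simp: vec_eq_iff)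
  obtain a where a: "\<psi> j $ a \<noteq> 0" using \<psi>[of j] by (auto simp: vec_eq_iff)
  have "0 < (cmod (u $ j * \<psi> j $ a))\<^sup>2
      * (\<Prod>n\<in>UNIV - {j}. (cmod (x j - x n) / cmod (x j - cnj (x n)))\<^sup>2) / (2 * Im (x j))"
    using j a pos[of j] inj upper_half_plane_diff_cnj_nonzero[OF pos pos]
    by (intro divide_pos_pos mult_pos_pos prod_pos) (auto simp: inj_eq)
  also have "\<dots> \<le> Re (cauchy_form x (\<lambda>k. u $ k * \<psi> k $ a) (\<lambda>k. u $ k * \<psi> k $ a))"
    by (rule cauchy_form_ge[OF pos])
  also have "\<dots> \<le> (\<Sum>a\<in>UNIV. Re (cauchy_form x (\<lambda>k. u $ k * \<psi> k $ a) (\<lambda>k. u $ k * \<psi> k $ a)))"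
    by (rule member_le_sum) (auto intro: cauchy_form_nonneg pos)
  finally show ?thesis by (simp add: gram_form_cauchy_form)
qed

lemma gram_form_add: "gram_form \<psi> x u (v + w) = gram_form \<psi> x u v + gram_form \<psi> x u w"
  by (simp add: gram_form_def algebra_simps sum.distrib)

lemma gram_form_scale: "gram_form \<psi> x u (c *s v) = c * gram_form \<psi> x u v"
  by (simp add: gram_form_def sum_distrib_left mult_ac)

lemma gram_form_tendsto:
  "f \<longlonglongrightarrow> a \<Longrightarrow> g \<longlonglongrightarrow> b \<Longrightarrow> (\<lambda>n. gram_form \<psi> x (f n) (g n)) \<longlonglongrightarrow> gram_form \<psi> x a b"
  unfolding gram_form_def by (intro tendsto_intros)

lemma gram_form_symmetric:
  fixes L :: "complex^'n^'n::finite"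
  assumes GL: "\<And>j l. (\<Sum>k\<in>UNIV. spinor_gram \<psi> x j k * L $ k $ l) = cnj (\<Sum>k\<in>UNIV. spinor_gram \<psi> x l k * L $ k $ j)"
  shows "gram_form \<psi> x u (L *v v) = gram_form \<psi> x (L *v u) v"
proof -
  define A where "A j l = (\<Sum>k\<in>UNIV. spinor_gram \<psi> x j k * L $ k $ l)" for j l
  have *: "gram_form \<psi> x u (L *v v) = (\<Sum>j\<in>UNIV. \<Sum>l\<in>UNIV. cnj (u $ j) * A j l * v $ l)" for u v
    unfolding gram_form_def
  proof (rule sum.cong[OF refl])
    fix j
    have "(\<Sum>k\<in>UNIV. cnj (u $ j) * spinor_gram \<psi> x j k * (L *v v) $ k)
        = (\<Sum>k\<in>UNIV. \<Sum>l\<in>UNIV. cnj (u $ j) * spinor_gram \<psi> x j k * L $ k $ l * v $ l)"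
      by (simp add: matrix_vector_mult_def sum_distrib_left mult.assoc)
    also have "\<dots> = (\<Sum>l\<in>UNIV. \<Sum>k\<in>UNIV. cnj (u $ j) * spinor_gram \<psi> x j k * L $ k $ l * v $ l)"
      by (rule sum.swap)
    finally show "(\<Sum>k\<in>UNIV. cnj (u $ j) * spinor_gram \<psi> x j k * (L *v v) $ k) = (\<Sum>l\<in>UNIV. cnj (u $ j) * A j l * v $ l)"
      by (simp add: A_def sum_distrib_left sum_distrib_right mult.assoc)
  qed
  have A: "cnj (A j l) = A l j" for j l
    using GL[of l j] by (simp add: A_def)
  have "gram_form \<psi> x (L *v u) v = cnj (gram_form \<psi> x v (L *v u))" by (rule gram_form_herm)
  also have "\<dots> = (\<Sum>j\<in>UNIV. \<Sum>l\<in>UNIV. v $ j * A l j * cnj (u $ l))"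
    unfolding * by (simp add: A)
  also have "\<dots> = (\<Sum>j\<in>UNIV. \<Sum>l\<in>UNIV. cnj (u $ j) * A j l * v $ l)"
    by (subst sum.swap) (simp add: mult_ac)
  finally show ?thesis unfolding * by simp
qed

text \<open>The skew-Hermitian part of the form multiplies the Gram entries by x_k - cnj x_j,
  exactly their denominator. What is left is the rank-two form of the constant \<Sum> u_k
  \<psi>_k.\<close>

lemma gram_form_dissipation:
  fixes u :: "complex^'n::finite"
  assumes pos: "\<And>j. Im (x j) > 0"
  shows "Im (gram_form \<psi> x u ((\<chi> j k. if j = k then x j else 0) *v u))
    = (\<Sum>a\<in>UNIV. (cmod (\<Sum>k\<in>UNIV. u $ k * \<psi> k $ a))\<^sup>2) / 2"
proof -
  let ?X = "(\<chi> j k. if j = k then x j else 0) :: complex^'n^'n"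
  define l where "l a = (\<Sum>k\<in>UNIV. u $ k * \<psi> k $ a)" for a
  have nz: "x k - cnj (x j) \<noteq> 0" for j k
    using upper_half_plane_diff_cnj_nonzero[OF pos pos] .
  have "gram_form \<psi> x u (?X *v u) - cnj (gram_form \<psi> x u (?X *v u))
      = gram_form \<psi> x u (?X *v u) - gram_form \<psi> x (?X *v u) u"
    by (simp flip: gram_form_herm)
  also have "\<dots> = (\<Sum>j\<in>UNIV. \<Sum>k\<in>UNIV. cnj (u $ j) * (spinor_gram \<psi> x j k * (x k - cnj (x j))) * u $ k)"
    unfolding gram_form_def diagonal_mult_vec sum_subtractf[symmetric]
    by (intro sum.cong refl) (simp add: algebra_simps)
  also have "\<dots> = (\<Sum>j\<in>UNIV. \<Sum>k\<in>UNIV. \<Sum>a\<in>UNIV. \<i> * (cnj (u $ j * \<psi> j $ a) * (u $ k * \<psi> k $ a)))"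
  proof (intro sum.cong refl)
    fix j k
    have "spinor_gram \<psi> x j k * (x k - cnj (x j)) = \<i> * (\<Sum>a\<in>UNIV. cnj (\<psi> j $ a) * \<psi> k $ a)"
      using nz[of k j] by (simp add: spinor_gram_def)
    then show "cnj (u $ j) * (spinor_gram \<psi> x j k * (x k - cnj (x j))) * u $ k
        = (\<Sum>a\<in>UNIV. \<i> * (cnj (u $ j * \<psi> j $ a) * (u $ k * \<psi> k $ a)))"
      by (simp add: sum_distrib_left sum_distrib_right mult_ac)
  qed
  also have "\<dots> = (\<Sum>j\<in>UNIV. \<Sum>a\<in>UNIV. \<Sum>k\<in>UNIV. \<i> * (cnj (u $ j * \<psi> j $ a) * (u $ k * \<psi> k $ a)))"
    by (rule sum.cong[OF refl], rule sum.swap)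
  also have "\<dots> = (\<Sum>a\<in>UNIV. \<Sum>j\<in>UNIV. \<Sum>k\<in>UNIV. \<i> * (cnj (u $ j * \<psi> j $ a) * (u $ k * \<psi> k $ a)))"
    by (rule sum.swap)
  also have "\<dots> = (\<Sum>a\<in>UNIV. \<i> * (cnj (l a) * l a))"
  proof -
    have "cnj (l a) * l a = (\<Sum>j\<in>UNIV. \<Sum>k\<in>UNIV. cnj (u $ j * \<psi> j $ a) * (u $ k * \<psi> k $ a))" for a
      by (simp only: l_def cnj_sum sum_product)
    then show ?thesis by (simp only: sum_distrib_left)
  qed
  also have "\<dots> = \<i> * of_real (\<Sum>a\<in>UNIV. (cmod (l a))\<^sup>2)"
    by (simp add: sum_distrib_left complex_norm_square mult.commute del: of_real_power)
  finally have "Im (gram_form \<psi> x u (?X *v u) - cnj (gram_form \<psi> x u (?X *v u))) = (\<Sum>a\<in>UNIV. (cmod (l a))\<^sup>2)"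
    by simp
  then show ?thesis by (simp add: l_def)
qed

text \<open>The commutator with the pole matrix clears the denominators of the Lax matrix and leaves
  -\<alpha> p_jk, also on the diagonal since p_jj = 0. It therefore acts through \<Sum> u_k
  \<psi>_k, the vector whose size is the dissipation.\<close>

lemma spin_lax_commute_diagonal:
  fixes u :: "complex^'n::finite"
  assumes inj: "inj x" and f: "\<And>j. spinor_factors (s j) (\<psi> j) (\<phi> j)"
    and u: "\<And>a. (\<Sum>k\<in>UNIV. u $ k * \<psi> k $ a) = 0"
  shows "spin_lax \<alpha> \<psi> \<phi> x x' *v ((\<chi> j k. if j = k then x j else 0) *v u)
       = (\<chi> j k. if j = k then x j else 0) *v (spin_lax \<alpha> \<psi> \<phi> x x' *v u)"
    (is "?L *v (?X *v u) = ?X *v (?L *v u)")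
proof (intro vec_eq_iff[THEN iffD2] allI)
  fix j
  have mv: "(M *v v) $ j = (\<Sum>k\<in>UNIV. M $ j $ k * v $ k)" for M :: "complex^'n^'n" and v
    by (simp add: matrix_vector_mult_def)
  have "(?L *v (?X *v u)) $ j - (?X *v (?L *v u)) $ j = (\<Sum>k\<in>UNIV. ?L $ j $ k * (x k - x j) * u $ k)"
    unfolding mv[of ?L "?X *v u"] diagonal_mult_vec mv[of ?L u] sum_distrib_left sum_subtractf[symmetric]
    by (intro sum.cong refl) (simp add: algebra_simps)
  also have "\<dots> = (\<Sum>k\<in>UNIV. - \<alpha> * spinor_pair (\<phi> j) (\<psi> k) * u $ k)"
  proof (rule sum.cong[OF refl])
    fix k
    show "?L $ j $ k * (x k - x j) * u $ k = - \<alpha> * spinor_pair (\<phi> j) (\<psi> k) * u $ k"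
    proof (cases "j = k")
      case True
      then show ?thesis by (simp add: spinor_pair_self[OF f])
    next
      case False
      then have "x j - x k \<noteq> 0" using inj by (auto dest: injD)
      then have "(x k - x j) / (x j - x k) = - 1" by (simp add: divide_eq_eq)
      then have "\<alpha> * spinor_pair (\<phi> j) (\<psi> k) * ((x k - x j) / (x j - x k)) * u $ k = - \<alpha> * spinor_pair (\<phi> j) (\<psi> k) * u $ k"
        by simp
      then show ?thesis using False by (simp add: spin_lax_def)
    qed
  qed
  also have "\<dots> = - \<alpha> * (\<phi> j $ 1 * (\<Sum>k\<in>UNIV. u $ k * \<psi> k $ 1) + \<phi> j $ 2 * (\<Sum>k\<in>UNIV. u $ k * \<psi> k $ 2))"
    by (simp add: spinor_pair_def sum_distrib_left sum.distrib sum_subtractf algebra_simps sum_negf)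
  also have "\<dots> = 0" by (simp add: u)
  finally show "(?L *v (?X *v u)) $ j = (?X *v (?L *v u)) $ j" by simp
qed

text \<open>For large times of either sign the eigenvalue gap applies to the poles as eigenvalues of
  the pencil; on the remaining compact interval continuity and positivity suffice.\<close>

lemma pole_height_bounded_below:
  fixes s :: "real \<Rightarrow> 'n::finite \<Rightarrow> complex^3" and x x' :: "real \<Rightarrow> 'n \<Rightarrow> complex"
  assumes \<sigma>: "\<sigma> \<in> {1, -1}" and dyn: "spin_pole_dynamics \<sigma> m0 s x x'"
    and con: "spin_pole_constraints m0 s x"
    and inj: "\<And>t. inj (x t)" and nz: "\<And>t j. s t j \<noteq> 0" and pos: "\<And>t j. Im (x t j) > 0"
  shows "\<exists>B>0. \<forall>t j. Im (x t j) \<ge> B"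
proof -
  have null: "cdot (s t j) (s t j) = 0" and orth: "cdot (s t j) (pole_field m0 (s t) (x t) j) = 0" for t j
    using con unfolding spin_pole_constraints_def by blast+
  obtain \<psi> \<phi> where f: "\<And>j. spinor_factors (s 0 j) (\<psi> j) (\<phi> j)"
    using spinor_factors_exist[OF null nz, of 0] by metis
  have \<psi>: "\<psi> j \<noteq> 0" for j
    using spinor_factors_nonzero[OF f nz, of j] by (metis zero_index)
  define L where "L = spin_lax (\<i> * \<sigma>) \<psi> \<phi> (x 0) (x' 0)"
  let ?X = "(\<chi> j k. if j = k then x 0 j else 0) :: complex^'n^'n"
  have x': "x' 0 j = of_real \<sigma> * cdot ((1 / cdot (s 0 j) (cconj (s 0 j))) *s ccross (s 0 j) (cconj (s 0 j)))
      (pole_field m0 (s 0) (x 0) j)" for j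
    using dyn unfolding spin_pole_dynamics_def by blast
  have comm: "L *v (?X *v u) = ?X *v (L *v u)" if "Im (gram_form \<psi> (x 0) u (?X *v u)) = 0" for u
  proof -
    have "(\<Sum>a\<in>UNIV. (cmod (\<Sum>k\<in>UNIV. u $ k * \<psi> k $ a))\<^sup>2) = 0"
      using that gram_form_dissipation[of "x 0" \<psi> u] pos by simp
    then have "(\<Sum>k\<in>UNIV. u $ k * \<psi> k $ a) = 0" for a
      by (subst (asm) sum_nonneg_eq_0_iff) auto
    then show ?thesis
      unfolding L_def by (rule spin_lax_commute_diagonal[OF inj f])
  qed
  have "\<exists>T. \<exists>B>0. \<forall>t \<mu> e. \<bar>t\<bar> \<ge> T \<and> e \<noteq> 0 \<and> of_real t *s (L *v e) + ?X *v e = \<mu> *s e \<longrightarrow> Im \<mu> \<ge> B"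
  proof (rule pencil_eigenvalue_gap[where h="gram_form \<psi> (x 0)"])
    show "gram_form \<psi> (x 0) u (L *v v) = gram_form \<psi> (x 0) (L *v u) v" for u v
      unfolding L_def by (rule gram_form_symmetric, rule spin_lax_gram_herm[OF \<sigma> pos inj f nz null orth x'])
    show "0 \<le> Im (gram_form \<psi> (x 0) u (?X *v u))" for u
      unfolding gram_form_dissipation[OF pos] by (simp add: sum_nonneg)
  qed (fact gram_form_add gram_form_scale gram_form_herm gram_form_pos[OF pos inj \<psi>]
      gram_form_tendsto comm pos)+
  then obtain T B where B: "B > 0"
    and gap: "\<And>t \<mu> e. \<bar>t\<bar> \<ge> T \<Longrightarrow> e \<noteq> 0 \<Longrightarrow> of_real t *s (L *v e) + ?X *v e = \<mu> *s e \<Longrightarrow> Im \<mu> \<ge> B"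
    by blast
  have large: "Im (x t j) \<ge> B" if "\<bar>t\<bar> \<ge> T" for t j
  proof -
    have "det (mat (x t j) - t *\<^sub>R L - ?X) = (\<Prod>k\<in>UNIV. x t j - x t k)"
      unfolding L_def by (rule pole_polynomial_spin_lax[OF \<sigma> dyn inj nz null f, symmetric])
    also have "\<dots> = 0" by (rule prod_zero) auto
    finally obtain e where "e \<noteq> 0" "of_real t *s (L *v e) + ?X *v e = x t j *s e"
      by (rule pencil_eigenvector)
    then show ?thesis by (rule gap[OF that])
  qed
  have "\<exists>b>0. \<forall>t\<in>{-\<bar>T\<bar>..\<bar>T\<bar>}. Im (x t j) \<ge> b" for j
  proof -
    have "continuous_on {-\<bar>T\<bar>..\<bar>T\<bar>} (\<lambda>t. x t j)"
      using dyn unfolding spin_pole_dynamics_def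
      by (intro continuous_at_imp_continuous_on ballI) (blast intro: has_vector_derivative_continuous)
    then have "continuous_on {-\<bar>T\<bar>..\<bar>T\<bar>} (\<lambda>t. Im (x t j))"
      by (intro continuous_intros)
    then obtain t0 where "\<forall>t\<in>{-\<bar>T\<bar>..\<bar>T\<bar>}. Im (x t0 j) \<le> Im (x t j)"
      using continuous_attains_inf[of "{-\<bar>T\<bar>..\<bar>T\<bar>}"] by auto
    then show ?thesis using pos by blast
  qed
  then obtain b where b: "\<And>j. b j > 0" "\<And>j t. t \<in> {-\<bar>T\<bar>..\<bar>T\<bar>} \<Longrightarrow> Im (x t j) \<ge> b j"
    by metis
  define B' where "B' = min B (Min (range b))"
  have "B' > 0" using B b(1) by (simp add: B'_def)
  moreover have "Im (x t j) \<ge> B'" for t j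
  proof (cases "\<bar>t\<bar> \<ge> T")
    case True
    then show ?thesis using large[of t j] by (simp add: B'_def)
  next
    case False
    then have "Im (x t j) \<ge> b j" by (intro b(2)) auto
    moreover have "Min (range b) \<le> b j" by simp
    ultimately show ?thesis unfolding B'_def by linarith
  qed
  ultimately show ?thesis by blast
qed

section \<open>Separation of the poles and the main result\<close>

text \<open>The asymptotic speeds are eigenvalues of the matrix with square roots, so the pencil
  identity is also needed for it. Here \<open>lax_signs\<close> supplies a globally differentiable
  Lax matrix, and no local choices arise.\<close>

lemma pole_polynomial_lax_L:
  fixes s :: "real \<Rightarrow> 'n::finite \<Rightarrow> complex^3" and x x' :: "real \<Rightarrow> 'n \<Rightarrow> complex"
  assumes dyn: "spin_pole_dynamics \<sigma> m0 s x x'" and signs: "lax_signs \<epsilon> s x x'" and inj: "\<And>t. inj (x t)"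
  shows "(\<Prod>j\<in>UNIV. z - x t j) = det (mat z - t *\<^sub>R lax_L (\<epsilon> 0) (s 0) (x 0) (x' 0)
     - (\<chi> j k. if j = k then x 0 j else 0))"
proof -
  define L where "L u = lax_L (\<epsilon> u) (s u) (x u) (x' u)" for u
  define B where "B u = lax_B (\<epsilon> u) (s u) (x u)" for u
  define pencil where "pencil u = mat z - (t - u) *\<^sub>R L u - (\<chi> j k. if j = k then x u j else 0)" for u
  have "(pencil has_vector_derivative (B u ** pencil u - pencil u ** B u)) (at u)" for u
  proof (rule lax_pencil_commutator[where L=L and z=z and \<tau>=t and x=x])
    show "(L has_vector_derivative (B u ** L u - L u ** B u)) (at u)"
      using signs unfolding lax_signs_def L_def[abs_def] B_def by blast
    show "((\<lambda>u. x u j) has_vector_derivative L u $ j $ j) (at u)" for j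
      using dyn unfolding spin_pole_dynamics_def by (simp add: L_def lax_L_def)
    show "L u $ j $ k = B u $ j $ k * (x u j - x u k)" if "j \<noteq> k" for j k
    proof -
      have "x u j - x u k \<noteq> 0" using inj that by (auto dest: injD)
      then show ?thesis using that by (simp add: L_def B_def lax_L_def lax_B_def power2_eq_square)
    qed
  qed (simp add: pencil_def)
  then have "det (pencil t) = det (pencil 0)"
    by (rule isospectral_det_constant) simp
  moreover have "det (pencil t) = (\<Prod>j\<in>UNIV. z - x t j)"
    by (subst det_diagonal) (auto simp: pencil_def mat_def)
  ultimately show ?thesis by (simp add: pencil_def L_def)
qed

section \<open>Behaviour of the poles at large times\<close>

lemma tendsto_det:
  fixes f :: "'a \<Rightarrow> complex^'n^'n::finite"
  shows "(f \<longlongrightarrow> A) F \<Longrightarrow> ((\<lambda>t. det (f t)) \<longlongrightarrow> det A) F"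
  unfolding det_def by (intro tendsto_intros)

text \<open>The quotients x_j(t) / t are the roots of the characteristic polynomial of L + X / t,
  which tends to that of \<open>L\<close>. Simple limit roots attract one quotient each, so the
  distances between poles grow linearly.\<close>

lemma distinct_speeds_separate_poles:
  fixes s :: "real \<Rightarrow> 'n::finite \<Rightarrow> complex^3" and x x' :: "real \<Rightarrow> 'n \<Rightarrow> complex"
  assumes dyn: "spin_pole_dynamics \<sigma> m0 s x x'" and inj: "\<And>t. inj (x t)"
    and speeds: "asymptotic_speeds s x x' v" and dist: "\<And>i j. i \<noteq> j \<Longrightarrow> v i \<noteq> v j"
  shows "\<exists>T>0. \<exists>\<delta>>0. \<forall>t>T. \<forall>j k. j \<noteq> k \<longrightarrow> \<delta> * t \<le> cmod (x t j - x t k)"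
proof -
  obtain \<epsilon> where signs: "lax_signs \<epsilon> s x x'"
    and ev: "eigenvalue_list (lax_L (\<epsilon> 0) (s 0) (x 0) (x' 0)) v"
    using speeds unfolding asymptotic_speeds_def by blast
  define L where "L = lax_L (\<epsilon> 0) (s 0) (x 0) (x' 0)"
  let ?X = "(\<chi> j k. if j = k then x 0 j else 0) :: complex^'n^'n"
  have scaled: "(\<Prod>j\<in>UNIV. w - x t j / of_real t) = det (mat w - L - (1 / t) *\<^sub>R ?X)" if "t > 0" for t w
  proof -
    have eq: "mat (of_real t * w) - t *\<^sub>R L - ?X = (\<chi> i. of_real t *s (mat w - L - (1 / t) *\<^sub>R ?X) $ i)"
      unfolding vec_eq_iff using that
      by (auto simp: mat_def vector_scaleR_component) (auto simp: scaleR_conv_of_real algebra_simps)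
    have "of_real t ^ CARD('n) * (\<Prod>j\<in>UNIV. w - x t j / of_real t) = (\<Prod>j\<in>UNIV. of_real t * (w - x t j / of_real t))"
      by (simp add: prod.distrib)
    also have "\<dots> = (\<Prod>j\<in>UNIV. of_real t * w - x t j)"
      using that by (intro prod.cong) (auto simp: algebra_simps)
    also have "\<dots> = det (mat (of_real t * w) - t *\<^sub>R L - ?X)"
      unfolding L_def by (rule pole_polynomial_lax_L[OF dyn signs inj])
    also have "\<dots> = of_real t ^ CARD('n) * det (mat w - L - (1 / t) *\<^sub>R ?X)"
      unfolding eq by (simp only: det_rows_mul vec_lambda_eta prod_constant)
    finally show ?thesis using that by simp
  qed
  have lim: "((\<lambda>t. \<Prod>j\<in>UNIV. v i - x t j / of_real t) \<longlongrightarrow> 0) at_top" for i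
  proof -
    have "((\<lambda>t. (1 / t) *\<^sub>R ?X) \<longlongrightarrow> 0 *\<^sub>R ?X) at_top"
      by (intro tendsto_intros tendsto_divide_0[OF tendsto_const] filterlim_at_top_imp_at_infinity filterlim_ident)
    then have "((\<lambda>t. mat (v i) - L - (1 / t) *\<^sub>R ?X) \<longlongrightarrow> mat (v i) - L - 0 *\<^sub>R ?X) at_top"
      by (rule tendsto_diff[OF tendsto_const])
    then have "((\<lambda>t. det (mat (v i) - L - (1 / t) *\<^sub>R ?X)) \<longlongrightarrow> det (mat (v i) - L - 0 *\<^sub>R ?X)) at_top"
      by (rule tendsto_det)
    moreover have "det (mat (v i) - L - 0 *\<^sub>R ?X) = (\<Prod>j\<in>UNIV. v i - v j)"
      using ev by (simp add: eigenvalue_list_def L_def)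
    moreover have "(\<Prod>j\<in>UNIV. v i - v j) = 0" by (rule prod_zero) auto
    moreover have "eventually (\<lambda>t. det (mat (v i) - L - (1 / t) *\<^sub>R ?X) = (\<Prod>j\<in>UNIV. v i - x t j / of_real t)) at_top"
      using eventually_gt_at_top[of "0::real"] by eventually_elim (simp add: scaled)
    ultimately show ?thesis using tendsto_cong by force
  qed
  define D where "D = (\<lambda>(i, j). cmod (v i - v j)) ` {(i, j). i \<noteq> j}"
  \<comment> \<open>A third of the smallest gap between speeds: two errors below \<delta> still
    leave a distance of at least \<delta>. The 1 keeps the minimum defined when there is a single
    pole.\<close>
  define \<delta> where "\<delta> = Min (insert 1 D) / 3"
  have "finite D" unfolding D_def by (rule finite_imageI) simp
  have \<delta>_le: "3 * \<delta> \<le> cmod (v i - v j)" if "i \<noteq> j" for i j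
  proof -
    have "cmod (v i - v j) \<in> insert 1 D" using that by (auto simp: D_def)
    with \<open>finite D\<close> have "Min (insert 1 D) \<le> cmod (v i - v j)" by (intro Min_le) auto
    then show ?thesis by (simp add: \<delta>_def)
  qed
  have \<delta>_pos: "\<delta> > 0"
    using \<open>finite D\<close> dist by (auto simp: \<delta>_def D_def)
  have "eventually (\<lambda>t. \<forall>i. cmod (\<Prod>j\<in>UNIV. v i - x t j / of_real t) < \<delta> ^ CARD('n)) at_top"
  proof (intro eventually_all_finite)
    show "eventually (\<lambda>t. cmod (\<Prod>j\<in>UNIV. v i - x t j / of_real t) < \<delta> ^ CARD('n)) at_top" for i
      using tendstoD[OF lim[of i], of "\<delta> ^ CARD('n)"] \<delta>_pos by simp
  qed
  then obtain T0 where T0: "\<And>t i. t \<ge> T0 \<Longrightarrow> cmod (\<Prod>j\<in>UNIV. v i - x t j / of_real t) < \<delta> ^ CARD('n)"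
    unfolding eventually_at_top_linorder by blast
  have "\<delta> * t \<le> cmod (x t j - x t k)" if t: "t > max T0 1" and jk: "j \<noteq> k" for t j k
  proof -
    have t0: "t > 0" using t by simp
    \<comment> \<open>A product of N factors below \<delta>^N has a factor below \<delta>. Discs of
      radius \<delta> around the speeds are disjoint, so the resulting choice of a quotient for each
      speed is injective, and hence a bijection.\<close>
    have "\<exists>j. cmod (v i - x t j / of_real t) < \<delta>" for i
    proof (rule ccontr)
      assume "\<not> ?thesis"
      then have "(\<Prod>j\<in>(UNIV::'n set). \<delta>) \<le> (\<Prod>j\<in>UNIV. cmod (v i - x t j / of_real t))"
        using \<delta>_pos by (intro prod_mono) (auto simp: not_less)
      then show False using T0[of t i] t by (simp add: prod_norm)
    qed
    then obtain p where p: "\<And>i. cmod (v i - x t (p i) / of_real t) < \<delta>" by metis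
    have "inj p"
    proof (rule injI, rule ccontr)
      fix i i' assume "p i = p i'" and ne: "i \<noteq> i'"
      have "cmod (v i - v i') \<le> cmod (v i - x t (p i) / of_real t) + cmod (v i' - x t (p i) / of_real t)"
        using norm_triangle_ineq4[of "v i - x t (p i) / of_real t" "v i' - x t (p i) / of_real t"] by simp
      also have "\<dots> < 3 * \<delta>" using p[of i] p[of i'] \<open>p i = p i'\<close> \<delta>_pos by simp
      finally show False using \<delta>_le[OF ne] by simp
    qed
    then have "surj p" by (rule finite_UNIV_inj_surj[rotated]) simp
    then obtain i i' where i: "j = p i" "k = p i'" by (metis surjD)
    then have "i \<noteq> i'" using jk by auto
    have "cmod (v i - v i') \<le> cmod (v i - x t j / of_real t) + cmod (x t j / of_real t - x t k / of_real t)
        + cmod (v i' - x t k / of_real t)"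
      using norm_triangle_ineq4[of "(v i - x t j / of_real t) + (x t j / of_real t - x t k / of_real t)" "v i' - x t k / of_real t"]
        norm_triangle_ineq[of "v i - x t j / of_real t" "x t j / of_real t - x t k / of_real t"] by simp
    then have "\<delta> \<le> cmod (x t j / of_real t - x t k / of_real t)"
      using \<delta>_le[OF \<open>i \<noteq> i'\<close>] p[of i] p[of i'] i by simp
    also have "\<dots> = cmod (x t j - x t k) / t"
      using t0 by (simp add: diff_divide_distrib[symmetric] norm_divide)
    finally show ?thesis using t0 by (simp add: le_divide_eq)
  qed
  then show ?thesis using \<delta>_pos by (intro exI[of _ "max T0 1"] conjI exI[of _ \<delta>]) auto
qed

theorem theorem0p1:
  fixes m :: "real \<Rightarrow> real \<Rightarrow> real^3"
    and m0 :: "real^3"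
    and s :: "real \<Rightarrow> 'n::finite \<Rightarrow> complex^3"
    and x x' :: "real \<Rightarrow> 'n \<Rightarrow> complex"
    and \<sigma> :: real
  assumes "half_wave_map m"
    and "has_rational_form m m0 s x"
    and "\<sigma> \<in> {1, -1}"
    and "spin_pole_dynamics \<sigma> m0 s x x'"
    and "spin_pole_constraints m0 s x"
  shows "(\<forall>v. asymptotic_speeds s x x' v \<and> (\<forall>i j. i \<noteq> j \<longrightarrow> v i \<noteq> v j) \<longrightarrow>
            (\<exists>T>0. \<exists>B\<^sub>1. \<exists>B\<^sub>2>0. \<forall>t>T. \<forall>j. norm (s t j) \<le> B\<^sub>1 \<and> Im (x t j) \<ge> B\<^sub>2))
       \<and> ((\<exists>\<eta>>0. \<forall>t j k. j \<noteq> k \<longrightarrow> cmod (x t j - x t k) \<ge> \<eta>) \<longrightarrow>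
            (\<exists>B\<^sub>1. \<exists>B\<^sub>2>0. \<forall>t j. norm (s t j) \<le> B\<^sub>1 \<and> Im (x t j) \<ge> B\<^sub>2))"
proof -
  have nz: "s t j \<noteq> 0" and pos: "Im (x t j) > 0" and inj: "inj (x t)" for t j
    using assms(2) unfolding has_rational_form_def by blast+
  obtain B\<^sub>2 where B\<^sub>2: "B\<^sub>2 > 0" "\<And>t j. Im (x t j) \<ge> B\<^sub>2"
    using pole_height_bounded_below[OF assms(3-5) inj nz pos] by blast
  define Y where "Y = (\<Sum>j\<in>UNIV. Im (x 0 j))"
  have Y: "Im (x t j) \<le> Y" for t j
    unfolding Y_def total_pole_height_constant[OF assms(4) pos, of t, symmetric]
    by (rule member_le_sum) (auto intro: less_imp_le pos)
  define C where "C = Re (cdot (\<Sum>j\<in>UNIV. s 0 j) (cvec m0))"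
  have C: "(\<Sum>i\<in>UNIV. Re (cauchy_form (x t) (\<lambda>k. s t k $ i) (\<lambda>k. s t k $ i))) = C" for t
    using mass_identity[of "s t" m0 "x t"] assms(5)
    unfolding spin_pole_constraints_def C_def total_spin_constant[OF assms(4), of t, symmetric]
    by (metis Re_sum)
  define bound where "bound \<eta> = sqrt (2 * Y * ((1 + 2 * Y / \<eta>)\<^sup>2) ^ (CARD('n) - 1) * C)" for \<eta>
  have spin: "norm (s t j) \<le> bound \<eta>"
    if "\<eta> > 0" "\<And>j k. j \<noteq> k \<Longrightarrow> \<eta> \<le> cmod (x t j - x t k)" for t j \<eta>
    unfolding bound_def using spin_bound[of "x t" Y j \<eta> "s t"] pos Y that
    by (intro real_le_rsqrt) (simp add: C)
  show ?thesis
  proof (intro conjI allI impI)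
    fix v assume v: "asymptotic_speeds s x x' v \<and> (\<forall>i j. i \<noteq> j \<longrightarrow> v i \<noteq> v j)"
    obtain T \<delta> where T: "T > 0" and \<delta>: "\<delta> > 0"
      and sep: "\<And>t j k. t > T \<Longrightarrow> j \<noteq> k \<Longrightarrow> \<delta> * t \<le> cmod (x t j - x t k)"
      using distinct_speeds_separate_poles[OF assms(4) inj, of v] v by metis
    \<comment> \<open>The separation \<delta> t exceeds the fixed value \<delta> T for t > T, which
      makes the bound independent of t.\<close>
    have "norm (s t j) \<le> bound (\<delta> * T)" if "t > T" for t j
    proof (rule spin)
      show "\<delta> * T > 0" using T \<delta> by simp
      show "\<delta> * T \<le> cmod (x t j - x t k)" if "j \<noteq> k" for j k
        using sep[OF \<open>t > T\<close> that] \<delta> \<open>t > T\<close> by (smt (verit) mult_strict_left_mono)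
    qed
    then show "\<exists>T>0. \<exists>B\<^sub>1. \<exists>B\<^sub>2>0. \<forall>t>T. \<forall>j. norm (s t j) \<le> B\<^sub>1 \<and> Im (x t j) \<ge> B\<^sub>2"
      using T B\<^sub>2 by blast
  next
    assume "\<exists>\<eta>>0. \<forall>t j k. j \<noteq> k \<longrightarrow> cmod (x t j - x t k) \<ge> \<eta>"
    then obtain \<eta> where "\<eta> > 0" "\<And>t j k. j \<noteq> k \<Longrightarrow> \<eta> \<le> cmod (x t j - x t k)" by blast
    then have "norm (s t j) \<le> bound \<eta>" for t j by (intro spin)
    then show "\<exists>B\<^sub>1. \<exists>B\<^sub>2>0. \<forall>t j. norm (s t j) \<le> B\<^sub>1 \<and> Im (x t j) \<ge> B\<^sub>2"
      using B\<^sub>2 by blast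
  qed
qed

end
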